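(* Let $\kappa_1(\sigma)=\frac{2\sigma}{\sigma+1}$ for $0\le\sigma<\infty$ and $\kappa_1(\infty)=2$. Consider the map $$\mathcal P:\ \sum_{\alpha\in\mathbf N^d}c_\alpha e_\alpha\ \mapsto\ \Big(z\mapsto\sum_{\alpha\in\mathbf N^d}c_\alpha\frac{z^\alpha}{\sqrt{\alpha!}}\Big)$$ from $\boldsymbol{\mathcal A}_0(\mathbf C^d)$ (finite sums) to $A(\mathbf C^d)$. Then the following is true: (1) if $\sigma\in(0,\infty]$, then $\mathcal P$ extends uniquely to a homeomorphism from $\boldsymbol{\mathcal A}_{0,\flat_\sigma}(\mathbf C^d)$ to $$\{F\in A(\mathbf C^d)\,;\,|F(z)|\lesssim e^{r|z|^{\kappa_1(\sigma)}}\ \text{for every } r>0\};$$ (2) if $\sigma\in(0,\infty)$, then $\mathcal P$ extends uniquely to a homeomorphism from $\boldsymbol{\mathcal A}_{\flat_\sigma}(\mathbf C^d)$ to $$\{F\in A(\mathbf C^d)\,;\,|F(z)|\lesssim e^{r|z|^{\kappa_1(\sigma)}}\ \text{for some } r>0\}.$$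
   Context: $A(\mathbf C^d)$ is the set of entire functions on $\mathbf C^d$; $f\lesssim g$ means $f\le cg$ for some constant $c>0$; $e_\alpha(z)=z^\alpha/\sqrt{\alpha!}$, $\alpha\in\mathbf N^d$, $\mathbf N=\{0,1,2,\dots\}$. The $\flat_\sigma$ ($\sigma>0$) are formal symbols, and $\flat_\infty=\frac12$. For $r>0$ and $\alpha\in\mathbf N^d$ let $\vartheta_{r,s}(\alpha)=e^{r|\alpha|^{1/(2s)}}$ when $s>0$ is real, and $\vartheta_{r,\flat_\sigma}(\alpha)=r^{|\alpha|}(\alpha!)^{1/(2\sigma)}$ when $0<\sigma<\infty$. For $p\in(0,\infty]$ and a positive function $\vartheta$ on $\mathbf N^d$, $\ell^p_{[\vartheta]}(\mathbf N^d)$ is the quasi-Banach space of all complex sequences with $\|\{c_\alpha\vartheta(\alpha)\}\|_{\ell^p}<\infty$. Let $\ell_{0,s}(\mathbf N^d)=\bigcap_{r>0}\ell^p_{[\vartheta_{r,s}]}(\mathbf N^d)$ with the projective limit topology and $\ell_s(\mathbf N^d)=\bigcup_{r>0}\ell^p_{[\vartheta_{r,s}]}(\mathbf N^d)$ with the inductive limit topology (these do not depend on $p$). The spaces $\boldsymbol{\mathcal A}_{0,s}(\mathbf C^d)$ and $\boldsymbol{\mathcal A}_s(\mathbf C^d)$ consist of all formal power series $\sum_\alpha c_\alpha e_\alpha$ with $\{c_\alpha\}$ in $\ell_{0,s}(\mathbf N^d)$ and $\ell_s(\mathbf N^d)$, respectively, with topologies transported from the sequence spaces; $\boldsymbol{\mathcal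 A}_0(\mathbf C^d)$ consists of all such sums with only finitely many nonzero $c_\alpha$. For a family $\{\omega_r\}_{r>0}$ of positive weights on $\mathbf C^d$, the set of $F\in A(\mathbf C^d)$ with $|F|\lesssim\omega_r$ for some (for every) $r>0$ carries the inductive (projective) limit topology of the Banach spaces $\{F\in A(\mathbf C^d)\,;\,\sup_z|F(z)|/\omega_r(z)<\infty\}$. *)

theory Defs
  imports "HOL-Analysis.Analysis"
begin

section \<open>Limits of function spaces\<close>

text \<open>All spaces occurring here are vector spaces of functions \<open>'x \<Rightarrow> complex\<close>: sequences
  indexed by multi-indices, and entire functions. The following is the topology of a quasi-normed
  space \<open>E\<close> with quasi-norm \<open>N\<close>. Balls of a quasi-norm need not be open, but they are
  neighbourhoods of their centres.\<close>

definition qnorm_topology :: "('x \<Rightarrow> complex) set \<Rightarrow> (('x \<Rightarrow> complex) \<Rightarrow> real) \<Rightarrow> ('x \<Rightarrow> complex) topology"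
  where "qnorm_topology E N = topology (\<lambda>U. U \<subseteq> E \<and>
    (\<forall>f\<in>U. \<exists>\<epsilon>>0. \<forall>g\<in>E. N (\<lambda>x. g x - f x) < \<epsilon> \<longrightarrow> g \<in> U))"

lemma openin_qnorm_topology:
  "openin (qnorm_topology E N) U \<longleftrightarrow> U \<subseteq> E \<and>
    (\<forall>f\<in>U. \<exists>\<epsilon>>0. \<forall>g\<in>E. N (\<lambda>x. g x - f x) < \<epsilon> \<longrightarrow> g \<in> U)"
proof -
  have "istopology (\<lambda>U. U \<subseteq> E \<and>
    (\<forall>f\<in>U. \<exists>\<epsilon>>0. \<forall>g\<in>E. N (\<lambda>x. g x - f x) < \<epsilon> \<longrightarrow> g \<in> U))" (is "istopology ?P")
    unfolding istopology_def
  proof (intro conjI allI impI)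
    fix S T assume S: "?P S" and T: "?P T"
    show "S \<inter> T \<subseteq> E" using S by blast
    show "\<forall>f\<in>S \<inter> T. \<exists>\<epsilon>>0. \<forall>g\<in>E. N (\<lambda>x. g x - f x) < \<epsilon> \<longrightarrow> g \<in> S \<inter> T"
    proof
      fix f assume f: "f \<in> S \<inter> T"
      obtain a where a: "a > 0" "\<forall>g\<in>E. N (\<lambda>x. g x - f x) < a \<longrightarrow> g \<in> S" using S f by blast
      obtain b where b: "b > 0" "\<forall>g\<in>E. N (\<lambda>x. g x - f x) < b \<longrightarrow> g \<in> T" using T f by blast
      show "\<exists>\<epsilon>>0. \<forall>g\<in>E. N (\<lambda>x. g x - f x) < \<epsilon> \<longrightarrow> g \<in> S \<inter> T"
        using a b by (intro exI[of _ "min a b"]) auto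
    qed
  next
    fix K assume K: "\<forall>S\<in>K. ?P S"
    show "\<Union>K \<subseteq> E" using K by blast
    show "\<forall>f\<in>\<Union>K. \<exists>\<epsilon>>0. \<forall>g\<in>E. N (\<lambda>x. g x - f x) < \<epsilon> \<longrightarrow> g \<in> \<Union>K"
    proof
      fix f assume "f \<in> \<Union>K"
      then obtain S where S: "S \<in> K" "f \<in> S" by blast
      then obtain a where "a > 0" "\<forall>g\<in>E. N (\<lambda>x. g x - f x) < a \<longrightarrow> g \<in> S" using K by blast
      with S show "\<exists>\<epsilon>>0. \<forall>g\<in>E. N (\<lambda>x. g x - f x) < \<epsilon> \<longrightarrow> g \<in> \<Union>K" by blast
    qed
  qed
  then show ?thesis unfolding qnorm_topology_def by (simp add: topology_inverse')
qed

lemma topspace_qnorm_topology [simp]: "topspace (qnorm_topology E N) = E"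
proof
  show "topspace (qnorm_topology E N) \<subseteq> E"
    using openin_topspace openin_qnorm_topology by blast
  have "openin (qnorm_topology E N) E"
    unfolding openin_qnorm_topology by (auto intro: exI[of _ 1])
  then show "E \<subseteq> topspace (qnorm_topology E N)" by (rule openin_subset)
qed

text \<open>The projective limit topology is the coarsest topology on the intersection for which all
  inclusions into the steps are continuous.\<close>

definition proj_lim :: "(real \<Rightarrow> ('x \<Rightarrow> complex) topology) \<Rightarrow> ('x \<Rightarrow> complex) topology"
  where "proj_lim T = topology_generated_by
    {(\<Inter>q\<in>{0<..}. topspace (T q)) \<inter> U | r U. r > 0 \<and> openin (T r) U}"

lemma topspace_proj_lim: "topspace (proj_lim T) = (\<Inter>r\<in>{0<..}. topspace (T r))"
proof
  let ?E = "\<Inter>q\<in>{0<..}. topspace (T q)"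
  show "topspace (proj_lim T) \<subseteq> ?E"
    unfolding proj_lim_def topology_generated_by_topspace by blast
  have "?E \<inter> topspace (T 1) \<in> {?E \<inter> U | r U. r > 0 \<and> openin (T r) U}"
    by (rule CollectI, rule exI[of _ 1], rule exI[of _ "topspace (T 1)"]) simp
  then have "?E \<inter> topspace (T 1) \<subseteq> topspace (proj_lim T)"
    unfolding proj_lim_def topology_generated_by_topspace by (rule Union_upper)
  moreover have "?E \<subseteq> topspace (T 1)" by (rule INF_lower) simp
  ultimately show "?E \<subseteq> topspace (proj_lim T)" by (simp add: Int_absorb2)
qed

definition absolutely_convex :: "('x \<Rightarrow> complex) set \<Rightarrow> bool"
  where "absolutely_convex V \<longleftrightarrow>
    (\<forall>f\<in>V. \<forall>g\<in>V. \<forall>a b. cmod a + cmod b \<le> 1 \<longrightarrow> (\<lambda>x. a * f x + b * g x) \<in> V)"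

text \<open>The inductive limit topology is understood in the locally convex sense: the finest locally
  convex topology on the union for which all inclusions of the steps are continuous. A basis of
  neighbourhoods of the origin consists of the absolutely convex sets that contain a neighbourhood
  of the origin in each step.\<close>

definition ind_lim :: "(real \<Rightarrow> ('x \<Rightarrow> complex) topology) \<Rightarrow> ('x \<Rightarrow> complex) topology"
  where "ind_lim T = topology (\<lambda>U. U \<subseteq> (\<Union>r\<in>{0<..}. topspace (T r)) \<and>
    (\<forall>f\<in>U. \<exists>V. absolutely_convex V \<and>
      (\<forall>r>0. \<exists>W. openin (T r) W \<and> (\<lambda>x. 0) \<in> W \<and> W \<subseteq> V) \<and>
      {g \<in> (\<Union>r\<in>{0<..}. topspace (T r)). (\<lambda>x. g x - f x) \<in> V} \<subseteq> U))"

lemma openin_ind_lim: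
  "openin (ind_lim T) U \<longleftrightarrow> U \<subseteq> (\<Union>r\<in>{0<..}. topspace (T r)) \<and>
    (\<forall>f\<in>U. \<exists>V. absolutely_convex V \<and>
      (\<forall>r>0. \<exists>W. openin (T r) W \<and> (\<lambda>x. 0) \<in> W \<and> W \<subseteq> V) \<and>
      {g \<in> (\<Union>r\<in>{0<..}. topspace (T r)). (\<lambda>x. g x - f x) \<in> V} \<subseteq> U)"
proof -
  define E where "E = (\<Union>r\<in>{0<..}. topspace (T r))"
  define Q where "Q V \<longleftrightarrow> absolutely_convex V \<and>
      (\<forall>r>0. \<exists>W. openin (T r) W \<and> (\<lambda>x. 0) \<in> W \<and> W \<subseteq> V)" for V
  have Q_Int: "Q (V \<inter> V')" if V: "Q V" and V': "Q V'" for V V'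
    unfolding Q_def
  proof (intro conjI allI impI)
    show "absolutely_convex (V \<inter> V')"
      using V V' unfolding Q_def absolutely_convex_def by blast
    fix r :: real assume r: "r > 0"
    obtain W where W: "openin (T r) W" "(\<lambda>x. 0) \<in> W" "W \<subseteq> V" using V r unfolding Q_def by blast
    obtain W' where W': "openin (T r) W'" "(\<lambda>x. 0) \<in> W'" "W' \<subseteq> V'"
      using V' r unfolding Q_def by blast
    show "\<exists>W. openin (T r) W \<and> (\<lambda>x. 0) \<in> W \<and> W \<subseteq> V \<inter> V'"
      using W W' by (intro exI[of _ "W \<inter> W'"]) auto
  qed
  have "istopology (\<lambda>U. U \<subseteq> E \<and> (\<forall>f\<in>U. \<exists>V. Q V \<and> {g \<in> E. (\<lambda>x. g x - f x) \<in> V} \<subseteq> U))"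
    (is "istopology ?P")
    unfolding istopology_def
  proof (intro conjI allI impI)
    fix S S' assume S: "?P S" and S': "?P S'"
    show "S \<inter> S' \<subseteq> E" using S by blast
    show "\<forall>f\<in>S \<inter> S'. \<exists>V. Q V \<and> {g \<in> E. (\<lambda>x. g x - f x) \<in> V} \<subseteq> S \<inter> S'"
    proof
      fix f assume f: "f \<in> S \<inter> S'"
      obtain V where V: "Q V" "{g \<in> E. (\<lambda>x. g x - f x) \<in> V} \<subseteq> S" using S f by blast
      obtain V' where V': "Q V'" "{g \<in> E. (\<lambda>x. g x - f x) \<in> V'} \<subseteq> S'" using S' f by blast
      show "\<exists>V. Q V \<and> {g \<in> E. (\<lambda>x. g x - f x) \<in> V} \<subseteq> S \<inter> S'"
        using V V' by (intro exI[of _ "V \<inter> V'"] conjI Q_Int) auto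
    qed
  next
    fix K assume K: "\<forall>S\<in>K. ?P S"
    show "\<Union>K \<subseteq> E" using K by blast
    show "\<forall>f\<in>\<Union>K. \<exists>V. Q V \<and> {g \<in> E. (\<lambda>x. g x - f x) \<in> V} \<subseteq> \<Union>K"
    proof
      fix f assume "f \<in> \<Union>K"
      then obtain S where S: "S \<in> K" "f \<in> S" by blast
      then obtain V where "Q V" "{g \<in> E. (\<lambda>x. g x - f x) \<in> V} \<subseteq> S" using K by blast
      with S show "\<exists>V. Q V \<and> {g \<in> E. (\<lambda>x. g x - f x) \<in> V} \<subseteq> \<Union>K" by blast
    qed
  qed
  then have "openin (ind_lim T) U \<longleftrightarrow> ?P U"
    unfolding ind_lim_def Q_def E_def conj_assoc by (simp add: topology_inverse')
  then show ?thesis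
    unfolding Q_def E_def conj_assoc .
qed

lemma topspace_ind_lim:
  assumes "\<And>r. r > 0 \<Longrightarrow> (\<lambda>x. 0) \<in> topspace (T r)"
  shows "topspace (ind_lim T) = (\<Union>r\<in>{0<..}. topspace (T r))"
proof
  show "topspace (ind_lim T) \<subseteq> (\<Union>r\<in>{0<..}. topspace (T r))"
    using openin_topspace openin_ind_lim by blast
  have "absolutely_convex UNIV" by (simp add: absolutely_convex_def)
  moreover have "\<forall>r>0. \<exists>W. openin (T r) W \<and> (\<lambda>x. 0) \<in> W \<and> W \<subseteq> UNIV"
    using assms openin_topspace by blast
  ultimately have "openin (ind_lim T) (\<Union>r\<in>{0<..}. topspace (T r))"
    unfolding openin_ind_lim by blast
  then show "(\<Union>r\<in>{0<..}. topspace (T r)) \<subseteq> topspace (ind_lim T)"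
    by (rule openin_subset)
qed


section \<open>Sequence spaces and spaces of formal power series\<close>

type_synonym 'd multi_index = "'d \<Rightarrow> nat"

definition mi_abs :: "'d::finite multi_index \<Rightarrow> nat"
  where "mi_abs \<alpha> = (\<Sum>i\<in>UNIV. \<alpha> i)"

definition mi_fact :: "'d::finite multi_index \<Rightarrow> real"
  where "mi_fact \<alpha> = (\<Prod>i\<in>UNIV. fact (\<alpha> i))"

text \<open>The formal symbols \<open>\<flat>\<^sub>\<sigma>\<close> with finite \<open>\<sigma>\<close> are kept apart from the real indices,
  whereas \<open>\<flat>\<^sub>\<infinity>\<close> is the real index \<open>1/2\<close>.\<close>

datatype ext_index = Real_Index real | Flat_Index real

definition flat :: "ereal \<Rightarrow> ext_index"
  where "flat \<sigma> = (if \<sigma> = \<infinity> then Real_Index (1/2) else Flat_Index (real_of_ereal \<sigma>))"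

primrec vartheta :: "real \<Rightarrow> ext_index \<Rightarrow> 'd::finite multi_index \<Rightarrow> real" where
  "vartheta r (Real_Index s) = (\<lambda>\<alpha>. exp (r * real (mi_abs \<alpha>) powr (1 / (2 * s))))"
| "vartheta r (Flat_Index \<sigma>) = (\<lambda>\<alpha>. r ^ mi_abs \<alpha> * mi_fact \<alpha> powr (1 / (2 * \<sigma>)))"

definition lp_set :: "ereal \<Rightarrow> ('i \<Rightarrow> real) \<Rightarrow> ('i \<Rightarrow> complex) set"
  where "lp_set p \<theta> = {c. if p = \<infinity> then bdd_above (range (\<lambda>\<alpha>. cmod (c \<alpha> * \<theta> \<alpha>)))
    else (\<lambda>\<alpha>. cmod (c \<alpha> * \<theta> \<alpha>) powr real_of_ereal p) summable_on UNIV}"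

definition lp_norm :: "ereal \<Rightarrow> ('i \<Rightarrow> real) \<Rightarrow> ('i \<Rightarrow> complex) \<Rightarrow> real"
  where "lp_norm p \<theta> c = (if p = \<infinity> then (SUP \<alpha>. cmod (c \<alpha> * \<theta> \<alpha>))
    else (\<Sum>\<^sub>\<infinity>\<alpha>. cmod (c \<alpha> * \<theta> \<alpha>) powr real_of_ereal p) powr (1 / real_of_ereal p))"

definition lp_space :: "ereal \<Rightarrow> ('i \<Rightarrow> real) \<Rightarrow> ('i \<Rightarrow> complex) topology"
  where "lp_space p \<theta> = qnorm_topology (lp_set p \<theta>) (lp_norm p \<theta>)"

text \<open>A formal power series \<open>\<Sum>\<^sub>\<alpha> c\<^sub>\<alpha> e\<^sub>\<alpha>\<close> is represented by its coefficient family \<open>c\<close>, so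
  the sequence spaces below serve at the same time as the spaces of formal power series with
  the transported topology. The exponent \<open>p\<close> is kept as a parameter, although the spaces do
  not depend on it.\<close>

type_synonym 'd formal_series = "'d multi_index \<Rightarrow> complex"

definition A_fin :: "'d::finite formal_series set"
  where "A_fin = {c. finite {\<alpha>. c \<alpha> \<noteq> 0}}"

definition A_proj :: "ereal \<Rightarrow> ext_index \<Rightarrow> 'd::finite formal_series topology"
  where "A_proj p s = proj_lim (\<lambda>r. lp_space p (vartheta r s))"

definition A_ind :: "ereal \<Rightarrow> ext_index \<Rightarrow> 'd::finite formal_series topology"
  where "A_ind p s = ind_lim (\<lambda>r. lp_space p (vartheta r s))"


section \<open>Spaces of entire functions\<close>

text \<open>Differentiability in the complex sense: the real derivative exists and is complex linear.\<close>

definition entire :: "(complex ^ 'd::finite \<Rightarrow> complex) \<Rightarrow> bool"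
  where "entire F \<longleftrightarrow> (\<forall>z. \<exists>D. (F has_derivative D) (at z) \<and> (\<forall>a v. D (a *s v) = a * D v))"

definition dominated :: "('x \<Rightarrow> real) \<Rightarrow> ('x \<Rightarrow> real) \<Rightarrow> bool"
  where "dominated f g \<longleftrightarrow> (\<exists>c>0. \<forall>x. f x \<le> c * g x)"

definition weighted_entire :: "(complex ^ 'd::finite \<Rightarrow> real) \<Rightarrow> (complex ^ 'd \<Rightarrow> complex) topology"
  where "weighted_entire \<omega> = qnorm_topology
    {F. entire F \<and> dominated (\<lambda>z. cmod (F z)) \<omega>} (\<lambda>F. SUP z. cmod (F z) / \<omega> z)"

definition entire_proj :: "(real \<Rightarrow> complex ^ 'd::finite \<Rightarrow> real) \<Rightarrow> (complex ^ 'd \<Rightarrow> complex) topology"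
  where "entire_proj \<omega> = proj_lim (\<lambda>r. weighted_entire (\<omega> r))"

definition entire_ind :: "(real \<Rightarrow> complex ^ 'd::finite \<Rightarrow> real) \<Rightarrow> (complex ^ 'd \<Rightarrow> complex) topology"
  where "entire_ind \<omega> = ind_lim (\<lambda>r. weighted_entire (\<omega> r))"

lemma topspace_entire_proj:
  "topspace (entire_proj \<omega>) = {F. entire F \<and> (\<forall>r>0. dominated (\<lambda>z. cmod (F z)) (\<omega> r))}"
  unfolding entire_proj_def topspace_proj_lim weighted_entire_def
  by (auto intro: zero_less_one)

lemma topspace_entire_ind:
  assumes "\<And>r z. r > 0 \<Longrightarrow> \<omega> r z > 0"
  shows "topspace (entire_ind \<omega>) = {F. entire F \<and> (\<exists>r>0. dominated (\<lambda>z. cmod (F z)) (\<omega> r))}"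
proof -
  have "entire (\<lambda>z. 0)"
    unfolding entire_def by (intro allI exI[of _ "\<lambda>v. 0"]) auto
  moreover have "dominated (\<lambda>z. cmod 0) (\<omega> r)" if "r > 0" for r
    unfolding dominated_def using assms[OF that] by (auto intro!: exI[of _ 1] less_imp_le)
  ultimately show ?thesis
    unfolding entire_ind_def weighted_entire_def by (subst topspace_ind_lim) auto
qed


section \<open>The power series map\<close>

definition basis_fun :: "'d::finite multi_index \<Rightarrow> complex ^ 'd \<Rightarrow> complex"
  where "basis_fun \<alpha> z = (\<Prod>i\<in>UNIV. (z $ i) ^ \<alpha> i) / sqrt (mi_fact \<alpha>)"

definition power_series_map :: "'d::finite formal_series \<Rightarrow> complex ^ 'd \<Rightarrow> complex"
  where "power_series_map c = (\<lambda>z. \<Sum>\<alpha> | c \<alpha> \<noteq> 0. c \<alpha> * basis_fun \<alpha> z)"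

definition kappa1 :: "ereal \<Rightarrow> real"
  where "kappa1 \<sigma> = (if \<sigma> = \<infinity> then 2 else 2 * real_of_ereal \<sigma> / (real_of_ereal \<sigma> + 1))"

text \<open>Maps out of \<open>topspace X\<close> are normalised to be \<open>undefined\<close> elsewhere, so that uniqueness
  refers to the values on \<open>topspace X\<close> only.\<close>

definition extends_uniquely_to_homeomorphism ::
    "('a \<Rightarrow> 'b) \<Rightarrow> 'a set \<Rightarrow> 'a topology \<Rightarrow> 'b topology \<Rightarrow> bool"
  where "extends_uniquely_to_homeomorphism P A X Y \<longleftrightarrow> A \<subseteq> topspace X \<and>
    (\<exists>!T. T \<in> extensional (topspace X) \<and> (\<forall>c\<in>A. T c = P c) \<and> homeomorphic_map X Y T)"

end

theory Submission
  imports Defs "HOL-Complex_Analysis.Cauchy_Integral_Formula"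
begin

text \<open>
Put \<open>\<tau> = 1 / (2 \<sigma>)\<close> (so \<open>\<tau> = 0\<close> for \<open>\<sigma> = \<infinity>\<close>). A series with coefficients \<open>c\<^sub>\<alpha>\<close> with respect to
\<open>z^\<alpha> / sqrt (\<alpha>!)\<close> and \<open>|c\<^sub>\<alpha>| \<le> M R^(-|\<alpha>|) (\<alpha>!)^(-\<tau>)\<close> has Taylor coefficients of size
\<open>R^(-|\<alpha>|) (\<alpha>!)^(-\<rho>)\<close> with \<open>\<rho> = \<tau> + 1/2\<close>, and \<open>1 / \<rho>\<close> is exactly the growth exponent \<open>\<kappa>\<close> of the
theorem. The theorem expresses that decay of order \<open>\<rho>\<close> of the Taylor coefficients is the same as
growth of order \<open>1 / \<rho>\<close> of the function, with explicit dependence of the constants.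

From decay to growth: \<open>y^n \<le> n! exp y\<close> raised to the power \<open>\<rho>\<close> bounds \<open>x^n\<close> by
\<open>(n!)^\<rho> exp (\<rho> x^\<kappa>)\<close>. Applied to each variable at \<open>2 |z\<^sub>i| / R\<close>, it bounds the terms of the series by
\<open>(1/2)^|\<alpha>| exp (r |z|^\<kappa>)\<close> with \<open>r\<close> proportional to \<open>R^(-\<kappa>)\<close> (\<open>growth_of_series_map\<close>). From growth to
decay: Cauchy's inequality on polycircles with radii proportional to \<open>(\<alpha>\<^sub>i + 1)^\<rho>\<close> gives back
\<open>(\<alpha>!)^(-\<rho>)\<close> up to a factor \<open>C^|\<alpha>|\<close> with \<open>C\<close> proportional to \<open>r^\<rho>\<close> (\<open>decay_of_taylor\<close>). Every estimate
has a geometric factor to spare, which makes the exponent \<open>p\<close> immaterial. Hence each step of one scale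
of spaces is mapped continuously into a step of the other, in both directions; this suffices for
continuity in the projective limit, and in the inductive limit by linearity. As \<open>r\<close> and \<open>R\<close> depend on
each other by inverse powers, each can be made as large or as small as required.

Bijectivity is the multivariate Taylor theorem: everywhere convergent power series are entire
(\<open>entire_power_series\<close>), their coefficients are unique (\<open>power_series_inj\<close>), and each entire function has such
an expansion, with Cauchy's inequalities (\<open>taylor_expansion_on_coordinates\<close>). The last two are proved by
induction on a finite set of coordinates, one variable at a time.

For uniqueness of the extension, truncations converge in each limit space (\<open>truncate_series_tendsto\<close>), and
point evaluations on the target are continuous.
\<close>

section \<open>Continuity and convergence in limits of quasi-normed spaces\<close>

text \<open>An open set contains with each of its points \<open>f\<close> some \<open>{g. N (g - f) < \<epsilon>}\<close>, and a Lipschitz estimate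
pulls these sets back to each other directly. The argument is therefore the same for norms and for
the quasi-norms with \<open>p < 1\<close>.\<close>

lemma continuous_map_qnorm:
  assumes "\<And>f. f \<in> E \<Longrightarrow> \<Phi> f \<in> E'" and "K > 0"
    and lip: "\<And>f g. \<lbrakk>f \<in> E; g \<in> E\<rbrakk> \<Longrightarrow> N' (\<lambda>x. \<Phi> g x - \<Phi> f x) \<le> K * N (\<lambda>x. g x - f x)"
  shows "continuous_map (qnorm_topology E N) (qnorm_topology E' N') \<Phi>"
  unfolding continuous_map_def topspace_qnorm_topology
proof (intro conjI allI impI)
  show "\<Phi> \<in> E \<rightarrow> E'" using assms(1) by blast
  fix U assume U: "openin (qnorm_topology E' N') U"
  show "openin (qnorm_topology E N) {f \<in> E. \<Phi> f \<in> U}"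
    unfolding openin_qnorm_topology
  proof (intro conjI ballI)
    fix f assume f: "f \<in> {f \<in> E. \<Phi> f \<in> U}"
    then obtain \<epsilon> where \<epsilon>: "\<epsilon> > 0" "\<forall>g\<in>E'. N' (\<lambda>x. g x - \<Phi> f x) < \<epsilon> \<longrightarrow> g \<in> U"
      using U unfolding openin_qnorm_topology by blast
    have "\<Phi> g \<in> U" if g: "g \<in> E" "N (\<lambda>x. g x - f x) < \<epsilon> / K" for g
    proof -
      have "N' (\<lambda>x. \<Phi> g x - \<Phi> f x) \<le> K * N (\<lambda>x. g x - f x)"
        using lip f g by blast
      also have "\<dots> < \<epsilon>" using g(2) \<open>K > 0\<close> by (simp add: field_simps)
      finally show ?thesis using \<epsilon>(2) assms(1) g(1) by blast
    qed
    then show "\<exists>\<epsilon>>0. \<forall>g\<in>E. N (\<lambda>x. g x - f x) < \<epsilon> \<longrightarrow> g \<in> {f \<in> E. \<Phi> f \<in> U}"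
      using \<epsilon>(1) \<open>K > 0\<close> by (intro exI[of _ "\<epsilon> / K"]) auto
  qed blast
qed

lemma limitin_qnorm:
  assumes "c \<in> E" "\<And>n. s n \<in> E" "((\<lambda>n. N (\<lambda>x. s n x - c x)) \<longlongrightarrow> 0) F"
  shows "limitin (qnorm_topology E N) s c F"
  unfolding limitin_def topspace_qnorm_topology
proof (intro conjI allI impI)
  fix U assume "openin (qnorm_topology E N) U \<and> c \<in> U"
  then obtain \<epsilon> where \<epsilon>: "\<epsilon> > 0" "\<forall>g\<in>E. N (\<lambda>x. g x - c x) < \<epsilon> \<longrightarrow> g \<in> U"
    unfolding openin_qnorm_topology by blast
  have "eventually (\<lambda>n. N (\<lambda>x. s n x - c x) < \<epsilon>) F"
    using order_tendstoD(2)[OF assms(3) \<epsilon>(1)] .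
  then show "eventually (\<lambda>n. s n \<in> U) F"
    by eventually_elim (use \<epsilon> assms(2) in blast)
qed (use assms in auto)

lemma openin_proj_lim_basic:
  assumes "r > 0" "openin (X r) U"
  shows "openin (proj_lim X) ((\<Inter>q\<in>{0<..}. topspace (X q)) \<inter> U)"
  unfolding proj_lim_def openin_topology_generated_by_iff
  by (rule generate_topology_on.Basis) (use assms in blast)

text \<open>Every step of the target must receive a whole step of the source, not only the intersection: a
preimage is then open in that one step, hence a generator of the projective limit topology.\<close>

lemma continuous_map_proj_lim:
  assumes step: "\<And>r. r > 0 \<Longrightarrow> \<exists>r'>0. continuous_map (X r') (Y r) \<Phi>"
  shows "continuous_map (proj_lim X) (proj_lim Y) \<Phi>"
proof -
  have maps: "\<Phi> c \<in> (\<Inter>q\<in>{0<..}. topspace (Y q))" if "c \<in> (\<Inter>q\<in>{0<..}. topspace (X q))" for c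
  proof (intro INT_I)
    fix r :: real assume "r \<in> {0<..}"
    then obtain r' where "r' > 0" "continuous_map (X r') (Y r) \<Phi>" using step by auto
    then show "\<Phi> c \<in> topspace (Y r)" using that unfolding continuous_map_def by auto
  qed
  show ?thesis
    unfolding proj_lim_def[of Y]
  proof (rule continuous_on_generated_topo)
    fix U' assume "U' \<in> {(\<Inter>q\<in>{0<..}. topspace (Y q)) \<inter> U |r U. 0 < r \<and> openin (Y r) U}"
    then obtain r U where U: "U' = (\<Inter>q\<in>{0<..}. topspace (Y q)) \<inter> U" "r > 0" "openin (Y r) U"
      by blast
    obtain r' where r': "r' > 0" "continuous_map (X r') (Y r) \<Phi>" using step U by auto
    have "openin (X r') {c \<in> topspace (X r'). \<Phi> c \<in> U}"
      using r' U by (simp add: openin_continuous_map_preimage)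
    from openin_proj_lim_basic[of r' X, OF r'(1) this]
    show "openin (proj_lim X) (\<Phi> -` U' \<inter> topspace (proj_lim X))"
      by (rule back_subst[of "openin (proj_lim X)"])
        (use maps r' in \<open>auto simp: U topspace_proj_lim\<close>)
  next
    show "\<Phi> ` topspace (proj_lim X) \<subseteq> \<Union> {(\<Inter>q\<in>{0<..}. topspace (Y q)) \<inter> U |r U. 0 < r \<and> openin (Y r) U}"
    proof
      fix F assume "F \<in> \<Phi> ` topspace (proj_lim X)"
      then have "F \<in> (\<Inter>q\<in>{0<..}. topspace (Y q))" using maps by (auto simp: topspace_proj_lim)
      also have "\<dots> = topspace (proj_lim Y)" by (simp add: topspace_proj_lim)
      finally show "F \<in> \<Union> {(\<Inter>q\<in>{0<..}. topspace (Y q)) \<inter> U |r U. 0 < r \<and> openin (Y r) U}"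
        by (simp only: proj_lim_def topology_generated_by_topspace)
    qed
  qed
qed

lemma continuous_map_from_proj_lim:
  assumes "r > 0" "continuous_map (X r) Z \<Phi>"
  shows "continuous_map (proj_lim X) Z \<Phi>"
proof -
  have "continuous_map (proj_lim X) (X r) (\<lambda>f. f)"
    unfolding continuous_map_def topspace_proj_lim
  proof (intro conjI allI impI)
    fix U assume U: "openin (X r) U"
    have "{f \<in> \<Inter>q\<in>{0<..}. topspace (X q). f \<in> U} = (\<Inter>q\<in>{0<..}. topspace (X q)) \<inter> U" by blast
    then show "openin (proj_lim X) {f \<in> \<Inter>q\<in>{0<..}. topspace (X q). f \<in> U}"
      using openin_proj_lim_basic[of r X, OF assms(1) U] by simp
  qed (use assms in auto)
  from continuous_map_compose[OF this assms(2)] show ?thesis by (simp add: o_def)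
qed

text \<open>The topology is given by generators, so convergence is checked on them: the open sets that
eventually contain the sequence whenever they contain the limit are closed under finite
intersections and unions.\<close>

lemma limitin_proj_lim:
  assumes lim: "\<And>r. r > 0 \<Longrightarrow> limitin (X r) s c F"
    and mem: "\<And>n r. r > 0 \<Longrightarrow> s n \<in> topspace (X r)"
  shows "limitin (proj_lim X) s c F"
  unfolding limitin_def
proof (intro conjI allI impI)
  show "c \<in> topspace (proj_lim X)"
    unfolding topspace_proj_lim using lim limitin_topspace by fastforce
  fix U assume U: "openin (proj_lim X) U \<and> c \<in> U"
  have "generate_topology_on {(\<Inter>q\<in>{0<..}. topspace (X q)) \<inter> U | r U. r > 0 \<and> openin (X r) U} U"
    using U unfolding proj_lim_def openin_topology_generated_by_iff by blast
  then have "c \<in> U \<longrightarrow> eventually (\<lambda>n. s n \<in> U) F"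
  proof induction
    case (Int a b)
    then show ?case by (auto intro: eventually_elim2)
  next
    case (UN K)
    show ?case
    proof
      assume "c \<in> \<Union>K"
      then obtain k where k: "k \<in> K" "c \<in> k" by blast
      with UN.IH have "eventually (\<lambda>n. s n \<in> k) F" by blast
      then show "eventually (\<lambda>n. s n \<in> \<Union>K) F"
        by eventually_elim (use k in blast)
    qed
  next
    case (Basis B)
    then obtain r V where V: "B = (\<Inter>q\<in>{0<..}. topspace (X q)) \<inter> V" "r > 0" "openin (X r) V"
      by blast
    show ?case
    proof
      assume "c \<in> B"
      then have "eventually (\<lambda>n. s n \<in> V) F"
        using lim[OF V(2)] V unfolding limitin_def by blast
      then show "eventually (\<lambda>n. s n \<in> B) F"
        by eventually_elim (use mem V in auto)
    qed
  qed simp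
  then show "eventually (\<lambda>n. s n \<in> U) F" using U by blast
qed

text \<open>Pulling back an absolutely convex neighbourhood of the origin under a linear map gives an absolutely
convex set; it is a neighbourhood of the origin as soon as it is one in each step.  The map
\<open>\<Phi>\<close> is linear on the union \<open>E\<close> of the steps, and in general not beyond: later it is an infinite sum that
converges on \<open>E\<close>.\<close>

lemma continuous_map_ind_lim:
  assumes step: "\<And>r. r > 0 \<Longrightarrow> \<exists>r'>0. continuous_map (X r) (Y r') \<Phi>"
    and zero: "\<And>r. r > 0 \<Longrightarrow> (\<lambda>x. 0) \<in> topspace (X r)"
    and zeroY: "\<And>r. r > 0 \<Longrightarrow> (\<lambda>x. 0) \<in> topspace (Y r)"
    and E: "E = (\<Union>r\<in>{0<..}. topspace (X r))"
    and sub: "\<And>a b f g. \<lbrakk>f \<in> E; g \<in> E\<rbrakk> \<Longrightarrow> (\<lambda>x. a * f x + b * g x) \<in> E"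
    and lin: "\<And>a b f g. \<lbrakk>f \<in> E; g \<in> E\<rbrakk> \<Longrightarrow>
      \<Phi> (\<lambda>x. a * f x + b * g x) = (\<lambda>x. a * \<Phi> f x + b * \<Phi> g x)"
  shows "continuous_map (ind_lim X) (ind_lim Y) \<Phi>"
proof -
  define E' where "E' = (\<Union>r\<in>{0<..}. topspace (Y r))"
  have maps: "\<Phi> f \<in> E'" if f: "f \<in> E" for f
  proof -
    obtain r where r: "r > 0" "f \<in> topspace (X r)" using f unfolding E by auto
    obtain r' where "r' > 0" "continuous_map (X r) (Y r') \<Phi>" using step r by blast
    then show ?thesis using r unfolding E'_def continuous_map_def by auto
  qed
  have 0: "(\<lambda>x. 0) \<in> E" using zero[of 1] unfolding E by auto
  have \<Phi>0: "\<Phi> (\<lambda>x. 0) = (\<lambda>x. 0)" using lin[OF 0 0, of 0 0] by simp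
  have diff: "\<Phi> (\<lambda>x. g x - f x) = (\<lambda>x. \<Phi> g x - \<Phi> f x)" if "f \<in> E" "g \<in> E" for f g
    using lin[OF that(2) that(1), of 1 "-1"] by simp
  have open_pre: "openin (ind_lim X) {f \<in> E. \<Phi> f \<in> U}" if U: "openin (ind_lim Y) U" for U
    unfolding openin_ind_lim E[symmetric]
  proof (intro conjI ballI)
    fix f assume f: "f \<in> {f \<in> E. \<Phi> f \<in> U}"
    then obtain V where V: "absolutely_convex V"
      "\<forall>r>0. \<exists>W. openin (Y r) W \<and> (\<lambda>x. 0) \<in> W \<and> W \<subseteq> V"
      "{g \<in> E'. (\<lambda>x. g x - \<Phi> f x) \<in> V} \<subseteq> U"
      using U unfolding openin_ind_lim E'_def by blast
    let ?V = "{g \<in> E. \<Phi> g \<in> V}"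
    have "absolutely_convex ?V"
      using V(1) unfolding absolutely_convex_def by (auto simp: lin intro!: sub)
    moreover have "\<exists>W. openin (X r) W \<and> (\<lambda>x. 0) \<in> W \<and> W \<subseteq> ?V" if r: "r > 0" for r
    proof -
      obtain r' where r': "r' > 0" "continuous_map (X r) (Y r') \<Phi>" using step r by blast
      obtain W where W: "openin (Y r') W" "(\<lambda>x. 0) \<in> W" "W \<subseteq> V" using V(2) r' by blast
      have "openin (X r) {g \<in> topspace (X r). \<Phi> g \<in> W}"
        using r' W by (simp add: openin_continuous_map_preimage)
      then show ?thesis
        using W zero[OF r] r \<Phi>0
        by (intro exI[of _ "{g \<in> topspace (X r). \<Phi> g \<in> W}"]) (auto simp: E)
    qed
    moreover have "{g \<in> E. (\<lambda>x. g x - f x) \<in> ?V} \<subseteq> {f \<in> E. \<Phi> f \<in> U}"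
      using V(3) f maps by (auto simp: diff)
    ultimately show "\<exists>V. absolutely_convex V \<and>
        (\<forall>r>0. \<exists>W. openin (X r) W \<and> (\<lambda>x. 0) \<in> W \<and> W \<subseteq> V) \<and>
        {g \<in> E. (\<lambda>x. g x - f x) \<in> V} \<subseteq> {f \<in> E. \<Phi> f \<in> U}"
      by blast
  qed blast
  have tX: "topspace (ind_lim X) = E" unfolding E by (rule topspace_ind_lim) (rule zero)
  have tY: "topspace (ind_lim Y) = E'" unfolding E'_def by (rule topspace_ind_lim) (rule zeroY)
  show ?thesis
    unfolding continuous_map_def tX tY using maps open_pre by blast
qed

lemma continuous_map_eval_ind_lim:
  assumes step: "\<And>r. r > 0 \<Longrightarrow> continuous_map (X r) euclidean (\<lambda>f. f z)"
    and zero: "\<And>r. r > 0 \<Longrightarrow> (\<lambda>x. 0) \<in> topspace (X r)"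
  shows "continuous_map (ind_lim X) euclidean (\<lambda>f. f z)"
proof -
  let ?E = "\<Union>r\<in>{0<..}. topspace (X r)"
  have tX: "topspace (ind_lim X) = ?E" by (rule topspace_ind_lim) (rule zero)
  have pre: "openin (ind_lim X) {f \<in> ?E. f z \<in> U}" if U: "open U" for U
    unfolding openin_ind_lim
  proof (intro conjI ballI)
    fix f assume f: "f \<in> {f \<in> ?E. f z \<in> U}"
    then obtain \<epsilon> where \<epsilon>: "\<epsilon> > 0" "\<And>w. dist w (f z) < \<epsilon> \<Longrightarrow> w \<in> U"
      using U unfolding open_dist by blast
    let ?V = "{g. cmod (g z) < \<epsilon>}"
    have "absolutely_convex ?V"
      unfolding absolutely_convex_def
    proof (intro ballI allI impI CollectI)
      fix g h a b assume g: "g \<in> ?V" and h: "h \<in> ?V" and ab: "cmod a + cmod b \<le> 1"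
      define m where "m = max (cmod (g z)) (cmod (h z))"
      have m: "cmod (g z) \<le> m" "cmod (h z) \<le> m" "m < \<epsilon>" "0 \<le> m"
        using g h unfolding m_def by (auto simp: le_max_iff_disj)
      have "cmod (a * g z + b * h z) \<le> cmod a * cmod (g z) + cmod b * cmod (h z)"
        by (metis norm_mult norm_triangle_ineq)
      also have "\<dots> \<le> cmod a * m + cmod b * m"
        using m by (intro add_mono mult_left_mono) auto
      also have "\<dots> = (cmod a + cmod b) * m" by (simp add: algebra_simps)
      also have "\<dots> \<le> 1 * m" using ab m by (intro mult_right_mono) auto
      finally show "cmod (a * g z + b * h z) < \<epsilon>" using m by simp
    qed
    moreover have "\<exists>W. openin (X r) W \<and> (\<lambda>x. 0) \<in> W \<and> W \<subseteq> ?V" if r: "r > 0" for r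
    proof -
      have "openin (X r) {g \<in> topspace (X r). g z \<in> ball 0 \<epsilon>}"
        by (rule openin_continuous_map_preimage[OF step[OF r]]) simp
      then show ?thesis using zero[OF r] \<epsilon>(1)
        by (intro exI[of _ "{g \<in> topspace (X r). g z \<in> ball 0 \<epsilon>}"]) auto
    qed
    moreover have "{g \<in> ?E. (\<lambda>x. g x - f x) \<in> ?V} \<subseteq> {f \<in> ?E. f z \<in> U}"
      using \<epsilon>(2) by (auto simp: dist_norm)
    ultimately show "\<exists>V. absolutely_convex V \<and>
        (\<forall>r>0. \<exists>W. openin (X r) W \<and> (\<lambda>x. 0) \<in> W \<and> W \<subseteq> V) \<and>
        {g \<in> ?E. (\<lambda>x. g x - f x) \<in> V} \<subseteq> {f \<in> ?E. f z \<in> U}"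
      by blast
  qed blast
  then show ?thesis unfolding continuous_map_def tX by simp
qed

text \<open>Convergence within a single step suffices, because a neighbourhood in the limit contains a
neighbourhood of each step.\<close>

lemma limitin_ind_lim:
  assumes "r > 0"
    and lim: "limitin (X r) (\<lambda>n x. s n x - c x) (\<lambda>x. 0) F"
    and zero: "\<And>r. r > 0 \<Longrightarrow> (\<lambda>x. 0) \<in> topspace (X r)"
    and mem: "\<And>n. s n \<in> topspace (ind_lim X)" "c \<in> topspace (ind_lim X)"
  shows "limitin (ind_lim X) s c F"
  unfolding limitin_def
proof (intro conjI allI impI)
  fix U assume "openin (ind_lim X) U \<and> c \<in> U"
  then obtain V where V: "\<forall>r>0. \<exists>W. openin (X r) W \<and> (\<lambda>x. 0) \<in> W \<and> W \<subseteq> V"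
     "{g \<in> (\<Union>r\<in>{0<..}. topspace (X r)). (\<lambda>x. g x - c x) \<in> V} \<subseteq> U"
    unfolding openin_ind_lim by blast
  obtain W where W: "openin (X r) W" "(\<lambda>x. 0) \<in> W" "W \<subseteq> V" using V(1) assms(1) by blast
  have "eventually (\<lambda>n. (\<lambda>x. s n x - c x) \<in> W) F"
    using lim W unfolding limitin_def by blast
  then show "eventually (\<lambda>n. s n \<in> U) F"
    by eventually_elim (use V(2) W(3) mem(1) topspace_ind_lim[of X, OF zero] in blast)
qed (use mem in auto)

text \<open>The elements of the target are functions, and the continuous point evaluations separate them. So two
continuous extensions agree at every limit of a sequence of \<open>A\<close>.\<close>

lemma extends_uniquely_to_homeomorphismI:
  fixes P :: "'a \<Rightarrow> 'x \<Rightarrow> complex"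
  assumes hom: "homeomorphic_map X Y T"
    and A: "A \<subseteq> topspace X" "\<And>c. c \<in> A \<Longrightarrow> T c = P c"
    and dense: "\<And>c. c \<in> topspace X \<Longrightarrow> \<exists>s. (\<forall>n::nat. s n \<in> A) \<and> limitin X s c sequentially"
    and eval: "\<And>z. continuous_map Y euclidean (\<lambda>F. F z)"
  shows "extends_uniquely_to_homeomorphism P A X Y"
  unfolding extends_uniquely_to_homeomorphism_def
proof (intro conjI)
  show "A \<subseteq> topspace X" by fact
  have hom': "homeomorphic_map X Y (restrict T (topspace X))"
    by (rule homeomorphic_map_eq[OF hom]) auto
  show "\<exists>!T. T \<in> extensional (topspace X) \<and> (\<forall>c\<in>A. T c = P c) \<and> homeomorphic_map X Y T"
  proof (rule ex1I[of _ "restrict T (topspace X)"])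
    show "restrict T (topspace X) \<in> extensional (topspace X) \<and>
      (\<forall>c\<in>A. restrict T (topspace X) c = P c) \<and> homeomorphic_map X Y (restrict T (topspace X))"
      using hom' A by auto
  next
    fix T' assume T': "T' \<in> extensional (topspace X) \<and> (\<forall>c\<in>A. T' c = P c) \<and> homeomorphic_map X Y T'"
    show "T' = restrict T (topspace X)"
    proof (rule extensionalityI[of _ "topspace X"])
      fix c assume c: "c \<in> topspace X"
      obtain s where s: "\<And>n::nat. s n \<in> A" "limitin X s c sequentially" using dense[OF c] by blast
      have lim: "(\<lambda>n. P (s n) z) \<longlonglongrightarrow> G c z"
        if G: "homeomorphic_map X Y G" "\<And>c. c \<in> A \<Longrightarrow> G c = P c" for G z
      proof -
        have "continuous_map X euclidean (\<lambda>c. G c z)"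
          using continuous_map_compose[OF homeomorphic_imp_continuous_map[OF G(1)] eval[of z]]
          by (simp add: o_def)
        from continuous_map_limit[OF this s(2)] show ?thesis
          using G(2) s(1) by (simp add: o_def)
      qed
      have "T' c z = T c z" for z
        using LIMSEQ_unique lim[of T' z] lim[of T z] T' hom A(2) by blast
      then show "T' c = restrict T (topspace X) c" using c by (simp add: fun_eq_iff)
    qed (use T' in auto)
  qed
qed

section \<open>Entire power series in several variables\<close>

definition monomial :: "'d::finite multi_index \<Rightarrow> complex ^ 'd \<Rightarrow> complex"
  where "monomial \<alpha> z = (\<Prod>i\<in>UNIV. (z $ i) ^ \<alpha> i)"

text \<open>Boundedness of \<open>a \<alpha> t^|\<alpha>|\<close> for every \<open>t\<close> is convergence everywhere: enlarging \<open>t\<close> turns it into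
geometric decay.\<close>

definition entire_coeffs :: "('d::finite multi_index \<Rightarrow> complex) \<Rightarrow> bool"
  where "entire_coeffs a \<longleftrightarrow> (\<forall>t>0. \<exists>M. \<forall>\<alpha>. cmod (a \<alpha>) * t ^ mi_abs \<alpha> \<le> M)"

definition power_series :: "('d::finite multi_index \<Rightarrow> complex) \<Rightarrow> complex ^ 'd \<Rightarrow> complex"
  where "power_series a z = (\<Sum>\<^sub>\<infinity>\<alpha>. a \<alpha> * monomial \<alpha> z)"

lemma power_mi_abs: "x ^ mi_abs \<alpha> = (\<Prod>i\<in>UNIV. x ^ \<alpha> i)"
  unfolding mi_abs_def by (rule power_sum)

text \<open>The sum over a box of multi-indices factors into a product of one-variable geometric sums, which
bounds all finite partial sums by \<open>(1 / (1 - x)) ^ d\<close>.\<close>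

lemma summable_on_geometric_mi:
  fixes x :: real
  assumes x: "0 \<le> x" "x < 1"
  shows "(\<lambda>\<alpha>::'d::finite multi_index. x ^ mi_abs \<alpha>) summable_on UNIV"
proof (rule nonneg_bdd_above_summable_on)
  show "bdd_above (sum (\<lambda>\<alpha>::'d multi_index. x ^ mi_abs \<alpha>) ` {F. F \<subseteq> UNIV \<and> finite F})"
  proof (rule bdd_aboveI2)
    fix F :: "'d multi_index set" assume "F \<in> {F. F \<subseteq> UNIV \<and> finite F}"
    then have F: "finite F" by simp
    define N where "N = Max (insert 0 (mi_abs ` F))"
    have le: "\<alpha> i \<le> N" if "\<alpha> \<in> F" for \<alpha> i
    proof -
      have "\<alpha> i \<le> mi_abs \<alpha>" unfolding mi_abs_def by (rule member_le_sum) auto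
      also have "\<dots> \<le> N" unfolding N_def using F that by (intro Max_ge) auto
      finally show ?thesis .
    qed
    have "(\<Sum>\<alpha>\<in>F. x ^ mi_abs \<alpha>) \<le> (\<Sum>\<alpha>\<in>PiE (UNIV :: 'd set) (\<lambda>_. {..N}). x ^ mi_abs \<alpha>)"
    proof (rule sum_mono2)
      show "finite (PiE (UNIV :: 'd set) (\<lambda>_. {..N}))" by (intro finite_PiE) auto
      show "F \<subseteq> PiE UNIV (\<lambda>_. {..N})" using le by auto
    qed (use x in auto)
    also have "\<dots> = (\<Prod>i\<in>(UNIV::'d set). \<Sum>n\<le>N. x ^ n)"
      unfolding power_mi_abs by (rule prod_sum_PiE[symmetric]) auto
    also have "\<dots> \<le> (\<Prod>i\<in>(UNIV::'d set). 1 / (1 - x))"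
    proof (intro prod_mono conjI sum_nonneg)
      have "(\<Sum>n\<le>N. x ^ n) \<le> (\<Sum>n. x ^ n)"
        using x by (intro sum_le_suminf summable_geometric) auto
      then show "(\<Sum>n\<le>N. x ^ n) \<le> 1 / (1 - x)" using x by (simp add: suminf_geometric)
    qed (use x in auto)
    finally show "(\<Sum>\<alpha>\<in>F. x ^ mi_abs \<alpha>) \<le> (\<Prod>i\<in>(UNIV::'d set). 1 / (1 - x))" .
  qed
qed (use x in auto)

lemma norm_monomial_le:
  assumes "\<And>i. cmod (z $ i) \<le> t"
  shows "cmod (monomial \<alpha> z) \<le> t ^ mi_abs \<alpha>"
  unfolding monomial_def power_mi_abs prod_norm[symmetric] norm_power
  by (intro prod_mono conjI power_mono assms) auto

lemma entire_coeffs_geometric_bound: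
  assumes a: "entire_coeffs a" and "t \<ge> 0"
  obtains M where "\<And>\<alpha>. cmod (a \<alpha>) * t ^ mi_abs \<alpha> \<le> M * (1/2) ^ mi_abs \<alpha>"
proof -
  obtain M where M: "\<And>\<alpha>. cmod (a \<alpha>) * (2 * t + 1) ^ mi_abs \<alpha> \<le> M"
    using a \<open>t \<ge> 0\<close> unfolding entire_coeffs_def by (metis add_nonneg_pos mult_2 add_increasing zero_less_one)
  have "cmod (a \<alpha>) * t ^ mi_abs \<alpha> \<le> M * (1/2) ^ mi_abs \<alpha>" for \<alpha>
  proof -
    have "cmod (a \<alpha>) * (2 * t) ^ mi_abs \<alpha> \<le> cmod (a \<alpha>) * (2 * t + 1) ^ mi_abs \<alpha>"
      using \<open>t \<ge> 0\<close> by (intro mult_left_mono power_mono) auto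
    with M[of \<alpha>] have "cmod (a \<alpha>) * (2 * t) ^ mi_abs \<alpha> \<le> M" by linarith
    then show ?thesis by (simp add: power_mult_distrib power_divide field_simps)
  qed
  then show ?thesis using that by blast
qed

lemma entire_coeffs_summable:
  assumes a: "entire_coeffs a"
  shows "(\<lambda>\<alpha>. norm (a \<alpha> * monomial \<alpha> z)) summable_on UNIV"
proof -
  obtain M where M: "\<And>\<alpha>. cmod (a \<alpha>) * (norm z) ^ mi_abs \<alpha> \<le> M * (1/2) ^ mi_abs \<alpha>"
    using entire_coeffs_geometric_bound[OF a norm_ge_zero] by blast
  show ?thesis
  proof (rule summable_on_comparison_test)
    show "(\<lambda>\<alpha>. M * (1/2) ^ mi_abs \<alpha>) summable_on (UNIV :: 'a multi_index set)"
      by (intro summable_on_cmult_right summable_on_geometric_mi) auto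
    fix \<alpha>
    have "norm (a \<alpha> * monomial \<alpha> z) \<le> cmod (a \<alpha>) * norm z ^ mi_abs \<alpha>"
      unfolding norm_mult by (intro mult_left_mono norm_monomial_le Finite_Cartesian_Product.norm_nth_le) auto
    then show "norm (a \<alpha> * monomial \<alpha> z) \<le> M * (1/2) ^ mi_abs \<alpha>" using M[of \<alpha>] by linarith
  qed auto
qed

lemma entire_coeffs_has_sum:
  "entire_coeffs a \<Longrightarrow> ((\<lambda>\<alpha>. a \<alpha> * monomial \<alpha> z) has_sum power_series a z) UNIV"
  unfolding power_series_def
  by (rule has_sum_infsum[OF abs_summable_summable[OF entire_coeffs_summable]])

lemma entire_coeffs_lincomb:
  assumes "entire_coeffs a" "entire_coeffs b"
  shows "entire_coeffs (\<lambda>\<alpha>. x * a \<alpha> + y * b \<alpha>)"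
  unfolding entire_coeffs_def
proof (intro allI impI)
  fix t :: real assume t: "t > 0"
  obtain M M' where M: "\<And>\<alpha>. cmod (a \<alpha>) * t ^ mi_abs \<alpha> \<le> M" "\<And>\<alpha>. cmod (b \<alpha>) * t ^ mi_abs \<alpha> \<le> M'"
    using assms t unfolding entire_coeffs_def by blast
  have "cmod (x * a \<alpha> + y * b \<alpha>) * t ^ mi_abs \<alpha> \<le> cmod x * M + cmod y * M'" for \<alpha>
  proof -
    have "cmod (x * a \<alpha> + y * b \<alpha>) * t ^ mi_abs \<alpha> \<le> (cmod x * cmod (a \<alpha>) + cmod y * cmod (b \<alpha>)) * t ^ mi_abs \<alpha>"
      using t by (intro mult_right_mono) (auto simp: norm_mult[symmetric] intro: norm_triangle_ineq)
    also have "\<dots> = cmod x * (cmod (a \<alpha>) * t ^ mi_abs \<alpha>) + cmod y * (cmod (b \<alpha>) * t ^ mi_abs \<alpha>)"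
      by (simp add: algebra_simps)
    also have "\<dots> \<le> cmod x * M + cmod y * M'"
      by (intro add_mono mult_left_mono M) auto
    finally show ?thesis .
  qed
  then show "\<exists>M. \<forall>\<alpha>. cmod (x * a \<alpha> + y * b \<alpha>) * t ^ mi_abs \<alpha> \<le> M" by blast
qed

lemma power_series_lincomb:
  assumes "entire_coeffs a" "entire_coeffs b"
  shows "power_series (\<lambda>\<alpha>. x * a \<alpha> + y * b \<alpha>) z = x * power_series a z + y * power_series b z"
proof -
  have "((\<lambda>\<alpha>. x * (a \<alpha> * monomial \<alpha> z) + y * (b \<alpha> * monomial \<alpha> z)) has_sum
      x * power_series a z + y * power_series b z) UNIV"
    by (intro has_sum_add has_sum_cmult_right entire_coeffs_has_sum assms)
  then show ?thesis
    unfolding power_series_def[of "\<lambda>\<alpha>. x * a \<alpha> + y * b \<alpha>"]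
    by (intro infsumI) (simp add: algebra_simps)
qed

definition monomial_deriv :: "'d::finite multi_index \<Rightarrow> complex ^ 'd \<Rightarrow> complex ^ 'd \<Rightarrow> complex"
  where "monomial_deriv \<alpha> z h =
    (\<Sum>i\<in>UNIV. of_nat (\<alpha> i) * h $ i * (z $ i) ^ (\<alpha> i - 1) * (\<Prod>j\<in>UNIV - {i}. (z $ j) ^ \<alpha> j))"

lemma has_derivative_monomial:
  "(monomial \<alpha> has_derivative monomial_deriv \<alpha> z) (at z within S)"
  unfolding monomial_def monomial_deriv_def
  by (intro has_derivative_prod has_derivative_power bounded_linear.has_derivative[OF bounded_linear_vec_nth]
      has_derivative_ident)

text \<open>Differentiation costs a factor \<open>|\<alpha>|\<close>, which \<open>2 ^ |\<alpha>|\<close> absorbs. The bound therefore has the same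
geometric shape as that for the monomial itself, at a larger radius.\<close>

lemma norm_monomial_deriv_le:
  assumes z: "\<And>i. cmod (z $ i) \<le> t" and "t \<ge> 1"
  shows "cmod (monomial_deriv \<alpha> z h) \<le> (2 * t) ^ mi_abs \<alpha> * norm h"
proof -
  have "cmod (monomial_deriv \<alpha> z h) \<le> (\<Sum>i\<in>UNIV. real (\<alpha> i) * (t ^ mi_abs \<alpha> * norm h))"
    unfolding monomial_deriv_def
  proof (rule order_trans[OF norm_sum], rule sum_mono)
    fix i :: 'a
    have "cmod (z $ i) ^ (\<alpha> i - 1) \<le> t ^ (\<alpha> i - 1)" using z by (intro power_mono) auto
    also have "\<dots> \<le> t ^ \<alpha> i" using \<open>t \<ge> 1\<close> by (intro power_increasing) auto
    finally have 1: "cmod (z $ i) ^ (\<alpha> i - 1) \<le> t ^ \<alpha> i" .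
    have 2: "(\<Prod>j\<in>UNIV - {i}. cmod (z $ j) ^ \<alpha> j) \<le> (\<Prod>j\<in>UNIV - {i}. t ^ \<alpha> j)"
      using z by (intro prod_mono conjI power_mono zero_le_power norm_ge_zero)
    have "t ^ mi_abs \<alpha> = t ^ \<alpha> i * (\<Prod>j\<in>UNIV - {i}. t ^ \<alpha> j)"
      unfolding power_mi_abs by (rule prod.remove) auto
    moreover have "cmod (z $ i) ^ (\<alpha> i - 1) * (\<Prod>j\<in>UNIV - {i}. cmod (z $ j) ^ \<alpha> j)
        \<le> t ^ \<alpha> i * (\<Prod>j\<in>UNIV - {i}. t ^ \<alpha> j)"
      using \<open>t \<ge> 1\<close> by (intro mult_mono 1 2) (auto intro!: prod_nonneg)
    ultimately have "norm h * (cmod (z $ i) ^ (\<alpha> i - 1) * (\<Prod>j\<in>UNIV - {i}. cmod (z $ j) ^ \<alpha> j))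
        \<le> norm h * t ^ mi_abs \<alpha>"
      by (intro mult_left_mono) auto
    moreover have "cmod (h $ i) * (cmod (z $ i) ^ (\<alpha> i - 1) * (\<Prod>j\<in>UNIV - {i}. cmod (z $ j) ^ \<alpha> j))
        \<le> norm h * (cmod (z $ i) ^ (\<alpha> i - 1) * (\<Prod>j\<in>UNIV - {i}. cmod (z $ j) ^ \<alpha> j))"
      by (rule mult_right_mono[OF Finite_Cartesian_Product.norm_nth_le]) (auto intro!: mult_nonneg_nonneg prod_nonneg)
    ultimately have "real (\<alpha> i) * (cmod (h $ i) * (cmod (z $ i) ^ (\<alpha> i - 1) * (\<Prod>j\<in>UNIV - {i}. cmod (z $ j) ^ \<alpha> j)))
       \<le> real (\<alpha> i) * (norm h * t ^ mi_abs \<alpha>)"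
      by (intro mult_left_mono) auto
    then show "cmod (of_nat (\<alpha> i) * h $ i * z $ i ^ (\<alpha> i - 1) * (\<Prod>j\<in>UNIV - {i}. z $ j ^ \<alpha> j))
         \<le> real (\<alpha> i) * (t ^ mi_abs \<alpha> * norm h)"
      by (simp only: norm_mult norm_power prod_norm[symmetric] norm_of_nat mult_ac)
  qed
  also have "\<dots> = real (mi_abs \<alpha>) * (t ^ mi_abs \<alpha> * norm h)"
    by (simp only: mi_abs_def of_nat_sum sum_distrib_right[symmetric])
  also have "\<dots> \<le> 2 ^ mi_abs \<alpha> * (t ^ mi_abs \<alpha> * norm h)"
    using \<open>t \<ge> 1\<close> by (intro mult_right_mono less_imp_le[OF of_nat_less_two_power]) simp
  finally show ?thesis by (simp only: power_mult_distrib mult.assoc)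
qed

lemma infinite_UNIV_multi_index: "infinite (UNIV :: 'd::finite multi_index set)"
proof -
  have "inj (\<lambda>n::nat. (\<lambda>_. n) :: 'd multi_index)"
    by (rule injI) (meson fun_cong)
  then show ?thesis
    using range_inj_infinite infinite_super[OF subset_UNIV] by metis
qed

text \<open>Termwise differentiation: by the previous bound the differentiated series is dominated on each
ball, uniformly in the direction, by a convergent numerical series. The multi-indices are enumerated
because the differentiation theorem is about sequences. Complex linearity of the derivative passes
to the sum.\<close>

lemma entire_power_series:
  assumes a: "entire_coeffs (a :: 'd::finite multi_index \<Rightarrow> complex)"
  shows "entire (power_series a)"
  unfolding entire_def
proof
  fix z0 :: "complex ^ 'd"
  define t where "t = norm z0 + 1"
  have t: "t \<ge> 1" unfolding t_def by simp
  define e where "e = from_nat_into (UNIV :: 'd multi_index set)"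
  have e: "bij_betw e UNIV UNIV"
    unfolding e_def using infinite_UNIV_multi_index by (intro bij_betw_from_nat_into) auto
  obtain M where M: "\<And>\<alpha>. cmod (a \<alpha>) * (2 * t) ^ mi_abs \<alpha> \<le> M * (1/2) ^ mi_abs \<alpha>"
    using entire_coeffs_geometric_bound[OF a, of "2 * t"] t by auto
  define b where "b n = M * (1/2) ^ mi_abs (e n)" for n
  have b: "summable b"
  proof -
    have "(\<lambda>\<alpha>::'d multi_index. M * (1/2) ^ mi_abs \<alpha>) summable_on UNIV"
      by (intro summable_on_cmult_right summable_on_geometric_mi) auto
    then have "b summable_on UNIV"
      unfolding b_def by (subst summable_on_reindex_bij_betw[OF e])
    then show ?thesis by (rule summable_on_imp_summable)
  qed
  let ?S = "ball 0 t :: (complex ^ 'd) set"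
  define f where "f n z = a (e n) * monomial (e n) z" for n z
  define f' where "f' n z h = a (e n) * monomial_deriv (e n) z h" for n z h
  define g' where "g' z h = (\<Sum>n. f' n z h)" for z h
  have f'_le: "cmod (f' n z h) \<le> b n * norm h" if "z \<in> ?S" for n z h
  proof -
    have "cmod (z $ i) \<le> t" for i using that Finite_Cartesian_Product.norm_nth_le[of z i] by simp
    then have "cmod (f' n z h) \<le> cmod (a (e n)) * ((2 * t) ^ mi_abs (e n) * norm h)"
      unfolding f'_def norm_mult by (intro mult_left_mono norm_monomial_deriv_le t) auto
    also have "\<dots> \<le> b n * norm h"
      using M[of "e n"] unfolding b_def by (simp add: mult.assoc[symmetric] mult_right_mono)
    finally show ?thesis .
  qed
  have f'_summable: "summable (\<lambda>n. f' n z h)" if "z \<in> ?S" for z h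
    by (rule summable_comparison_test'[OF summable_mult2[OF b, of "norm h"], of 0]) (rule f'_le[OF that])
  have sums: "(\<lambda>n. f n z) sums power_series a z" for z
  proof (rule has_sum_imp_sums)
    show "((\<lambda>n. f n z) has_sum power_series a z) UNIV"
      unfolding f_def using entire_coeffs_has_sum[OF a, of z]
      by (simp add: has_sum_reindex_bij_betw[OF e, of "\<lambda>\<alpha>. a \<alpha> * monomial \<alpha> z"])
  qed
  have "\<exists>g. \<forall>z\<in>?S. (\<lambda>n. f n z) sums (g z) \<and> (g has_derivative g' z) (at z within ?S)"
  proof (rule has_derivative_series)
    show "convex ?S" by simp
    show "(f n has_derivative f' n z) (at z within ?S)" for n z
      unfolding f_def f'_def by (intro has_derivative_mult_right has_derivative_monomial)
    show "0 \<in> ?S" using t by simp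
    show "(\<lambda>n. f n 0) sums power_series a 0" by (rule sums)
    fix \<epsilon> :: real assume "\<epsilon> > 0"
    have "(\<lambda>n. suminf b - (\<Sum>i<n. b i)) \<longlonglongrightarrow> suminf b - suminf b"
      using summable_sums[OF b] unfolding sums_def by (intro tendsto_intros)
    then have "(\<lambda>n. suminf b - (\<Sum>i<n. b i)) \<longlonglongrightarrow> 0" by simp
    from order_tendstoD(2)[OF this \<open>\<epsilon> > 0\<close>]
    show "\<forall>\<^sub>F n in sequentially. \<forall>z\<in>?S. \<forall>h. norm ((\<Sum>i<n. f' i z h) - g' z h) \<le> \<epsilon> * norm h"
    proof eventually_elim
      case (elim n)
      show ?case
      proof (intro ballI allI)
        fix z h assume z: "z \<in> ?S"
        have "g' z h - (\<Sum>i<n. f' i z h) = (\<Sum>i. f' (i + n) z h)"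
          unfolding g'_def using suminf_split_initial_segment[OF f'_summable[OF z], of h n] by simp
        also have "norm \<dots> \<le> (\<Sum>i. b (i + n) * norm h)"
          using f'_le[OF z] b by (intro norm_suminf_le summable_mult2) (auto simp: summable_iff_shift)
        also have "\<dots> = (suminf b - (\<Sum>i<n. b i)) * norm h"
          using suminf_split_initial_segment[OF b, of n] b
          by (subst suminf_mult2[symmetric]) (auto simp: summable_iff_shift)
        also have "\<dots> \<le> \<epsilon> * norm h" using elim by (intro mult_right_mono) auto
        finally show "norm ((\<Sum>i<n. f' i z h) - g' z h) \<le> \<epsilon> * norm h"
          by (simp add: norm_minus_commute)
      qed
    qed
  qed
  then obtain g where g: "\<And>z. z \<in> ?S \<Longrightarrow> (\<lambda>n. f n z) sums (g z)"
      "\<And>z. z \<in> ?S \<Longrightarrow> (g has_derivative g' z) (at z within ?S)" by blast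
  have z0: "z0 \<in> ?S" unfolding t_def by simp
  have "(g has_derivative g' z0) (at z0)"
    using g(2)[OF z0] at_within_open[OF z0] by simp
  then have "(power_series a has_derivative g' z0) (at z0)"
    by (rule has_derivative_transform_within_open[OF _ open_ball z0])
      (rule sums_unique2[OF g(1) sums])
  moreover have "g' z0 (c *s h) = c * g' z0 h" for c h
  proof -
    have "f' n z0 (c *s h) = c * f' n z0 h" for n
      unfolding f'_def monomial_deriv_def by (simp add: sum_distrib_left mult_ac)
    then show ?thesis unfolding g'_def using suminf_mult[OF f'_summable[OF z0]] by simp
  qed
  ultimately show "\<exists>D. (power_series a has_derivative D) (at z0) \<and> (\<forall>c v. D (c *s v) = c * D v)"
    by blast
qed

lemma prod_power_split_coordinate:
  fixes x :: "'d::finite \<Rightarrow> 'a::comm_monoid_mult"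
  shows "(\<Prod>i\<in>UNIV. x i ^ \<alpha> i) = x j ^ \<alpha> j * (\<Prod>i\<in>UNIV. x i ^ (\<alpha>(j := 0)) i)"
proof -
  have "(\<Prod>i\<in>UNIV. x i ^ \<alpha> i) = x j ^ \<alpha> j * (\<Prod>i\<in>UNIV - {j}. x i ^ \<alpha> i)"
    by (rule prod.remove) auto
  also have "(\<Prod>i\<in>UNIV - {j}. x i ^ \<alpha> i) = (\<Prod>i\<in>UNIV - {j}. x i ^ (\<alpha>(j := 0)) i)"
    by (rule prod.cong) auto
  also have "\<dots> = (\<Prod>i\<in>UNIV. x i ^ (\<alpha>(j := 0)) i)"
    by (subst (2) prod.remove[of _ j]) auto
  finally show ?thesis .
qed

text \<open>The coefficient of \<open>(z $ j) ^ n\<close> in a power series in \<open>z\<close>, itself a power series in the remaining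
variables. It stays indexed by all multi-indices, so that one type serves every number of variables
and inductions can run over finite sets of coordinates.\<close>

definition slice :: "'d::finite \<Rightarrow> nat \<Rightarrow> ('d multi_index \<Rightarrow> complex) \<Rightarrow> 'd multi_index \<Rightarrow> complex"
  where "slice j n a \<beta> = (if \<beta> j = 0 then a (\<beta>(j := n)) else 0)"

lemma entire_coeffs_slice:
  assumes a: "entire_coeffs a"
  shows "entire_coeffs (slice j n a)"
  unfolding entire_coeffs_def
proof (intro allI impI)
  fix t :: real assume t: "t > 0"
  obtain M where M: "\<And>\<alpha>. cmod (a \<alpha>) * t ^ mi_abs \<alpha> \<le> M"
    using a t unfolding entire_coeffs_def by blast
  have "0 \<le> cmod (a (\<lambda>_. 0)) * t ^ mi_abs (\<lambda>_::'a. 0)" using t by simp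
  then have M0: "M \<ge> 0" using M[of "\<lambda>_. 0"] by linarith
  have "cmod (slice j n a \<beta>) * t ^ mi_abs \<beta> \<le> M / t ^ n" for \<beta>
  proof (cases "\<beta> j = 0")
    case True
    then have [simp]: "\<beta>(j := 0) = \<beta>" by auto
    have "t ^ mi_abs (\<beta>(j := n)) = t ^ n * t ^ mi_abs \<beta>"
      unfolding power_mi_abs using prod_power_split_coordinate[of "\<lambda>_. t" "\<beta>(j := n)" j] by simp
    with M[of "\<beta>(j := n)"] t True show ?thesis
      by (simp add: slice_def field_simps)
  qed (use M0 t in \<open>simp add: slice_def\<close>)
  then show "\<exists>M. \<forall>\<beta>. cmod (slice j n a \<beta>) * t ^ mi_abs \<beta> \<le> M" by blast
qed

text \<open>Absolute convergence allows the sum to be grouped by the exponent of one variable.\<close>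

lemma power_series_slices:
  assumes a: "entire_coeffs a"
  shows "(\<lambda>n. power_series (slice j n a) z * (z $ j) ^ n) sums power_series a z"
proof (rule has_sum_imp_sums, rule has_sum_SigmaD)
  let ?B = "\<lambda>_. {\<beta>. \<beta> j = 0}"
  let ?f = "\<lambda>(n, \<beta>). a (\<beta>(j := n)) * monomial (\<beta>(j := n)) z"
  have "bij_betw (\<lambda>(n, \<beta>). \<beta>(j := n)) (Sigma UNIV ?B) UNIV"
    by (rule bij_betw_byWitness[where f' = "\<lambda>\<alpha>. (\<alpha> j, \<alpha>(j := 0))"]) auto
  from has_sum_reindex_bij_betw[OF this, of "\<lambda>\<alpha>. a \<alpha> * monomial \<alpha> z"] entire_coeffs_has_sum[OF a, of z]
  show "(?f has_sum power_series a z) (Sigma UNIV ?B)"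
    by (simp add: case_prod_unfold)
  fix n :: nat
  have "((\<lambda>\<beta>. slice j n a \<beta> * monomial \<beta> z) has_sum power_series (slice j n a) z) UNIV"
    by (intro entire_coeffs_has_sum entire_coeffs_slice a)
  then have "((\<lambda>\<beta>. slice j n a \<beta> * monomial \<beta> z) has_sum power_series (slice j n a) z) {\<beta>. \<beta> j = 0}"
    by (rule has_sum_cong_neutral[THEN iffD1, rotated -1]) (auto simp: slice_def)
  then have "((\<lambda>\<beta>. slice j n a \<beta> * monomial \<beta> z * (z $ j) ^ n) has_sum
      power_series (slice j n a) z * (z $ j) ^ n) {\<beta>. \<beta> j = 0}"
    by (rule has_sum_cmult_left)
  also have "?this \<longleftrightarrow> ((\<lambda>\<beta>. ?f (n, \<beta>)) has_sum power_series (slice j n a) z * (z $ j) ^ n) {\<beta>. \<beta> j = 0}"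
  proof (rule has_sum_cong)
    fix \<beta> :: "'a multi_index" assume "\<beta> \<in> {\<beta>. \<beta> j = 0}"
    then have \<beta>: "\<beta> j = 0" "\<beta>(j := 0) = \<beta>" by auto
    then show "slice j n a \<beta> * monomial \<beta> z * (z $ j) ^ n = ?f (n, \<beta>)"
      using prod_power_split_coordinate[of "\<lambda>i. z $ i" "\<beta>(j := n)" j]
      by (simp add: slice_def monomial_def mult_ac)
  qed
  finally show "((\<lambda>\<beta>. ?f (n, \<beta>)) has_sum power_series (slice j n a) z * (z $ j) ^ n) {\<beta>. \<beta> j = 0}" .
qed

lemma power_series_cong_support:
  assumes "\<And>\<alpha>. a \<alpha> \<noteq> 0 \<Longrightarrow> \<alpha> j = 0" "\<And>i. i \<noteq> j \<Longrightarrow> z $ i = w $ i"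
  shows "power_series a z = power_series a w"
  unfolding power_series_def
proof (rule infsum_cong)
  fix \<alpha> show "a \<alpha> * monomial \<alpha> z = a \<alpha> * monomial \<alpha> w"
  proof (cases "a \<alpha> = 0")
    case False
    have "monomial \<alpha> z = monomial \<alpha> w"
      unfolding monomial_def
    proof (rule prod.cong)
      fix i show "z $ i ^ \<alpha> i = w $ i ^ \<alpha> i" using assms(1)[OF False] assms(2)[of i] by (cases "i = j") auto
    qed auto
    then show ?thesis by simp
  qed simp
qed

lemma power_series_at_constant:
  assumes "\<And>\<alpha>. a \<alpha> \<noteq> 0 \<Longrightarrow> \<alpha> = (\<lambda>_. 0)"
  shows "power_series a z = a (\<lambda>_. 0)"
  unfolding power_series_def
proof (rule infsumI)
  show "((\<lambda>\<alpha>. a \<alpha> * monomial \<alpha> z) has_sum a (\<lambda>_. 0)) UNIV"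
    by (rule has_sum_finite_neutralI[of "{\<lambda>_. 0}"]) (use assms in \<open>auto simp: monomial_def\<close>)
qed

lemma power_series_1_eq_0:
  fixes c :: "nat \<Rightarrow> complex"
  assumes "\<And>w. (\<lambda>n. c n * w ^ n) sums 0"
  shows "c n = 0"
proof (rule ccontr)
  assume "c n \<noteq> 0"
  moreover have "c 0 = 0"
    using sums_unique2[OF assms[of 0] powser_sums_zero[of c]] by simp
  ultimately have n: "c n \<noteq> 0" "n > 0" by (auto intro: gr0I)
  obtain s where s: "0 < s" "\<And>z::complex. z \<in> cball 0 s - {0} \<Longrightarrow> (0::complex) \<noteq> 0"
    using powser_0_nonzero[of 1 0 c "\<lambda>_. 0" n] n assms by (metis diff_zero zero_less_one)
  have "of_real s \<in> cball 0 s - {0 :: complex}" using s(1) by simp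
  from s(2)[OF this] show False by simp
qed

text \<open>Induction on the set of variables that occur. For fixed values of the other variables the grouped
series is a vanishing power series in the variable \<open>j\<close>, so each slice vanishes identically; slices
involve one variable less.\<close>

lemma power_series_eq_0_imp:
  fixes a :: "'d::finite multi_index \<Rightarrow> complex"
  assumes "entire_coeffs a" and "\<And>z. power_series a z = 0"
  shows "a \<alpha> = 0"
proof -
  have "\<forall>a :: 'd multi_index \<Rightarrow> complex. entire_coeffs a \<longrightarrow> (\<forall>\<alpha>. a \<alpha> \<noteq> 0 \<longrightarrow> (\<forall>i. i \<notin> I \<longrightarrow> \<alpha> i = 0)) \<longrightarrow>
      (\<forall>z. power_series a z = 0) \<longrightarrow> (\<forall>\<alpha>. a \<alpha> = 0)" if "finite I" for I
    using that
  proof (induction I rule: finite_induct)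
    case empty
    show ?case
    proof (intro allI impI)
      fix a :: "'d multi_index \<Rightarrow> complex" and \<alpha>
      assume supp: "\<forall>\<alpha>. a \<alpha> \<noteq> 0 \<longrightarrow> (\<forall>i. i \<notin> {} \<longrightarrow> \<alpha> i = 0)" and 0: "\<forall>z. power_series a z = 0"
      have *: "\<alpha> = (\<lambda>_. 0)" if "a \<alpha> \<noteq> 0" for \<alpha> using supp that by auto
      have "a (\<lambda>_. 0) = power_series a 0" by (rule power_series_at_constant[symmetric]) (rule *)
      then show "a \<alpha> = 0" using * 0 by metis
    qed
  next
    case (insert j I)
    show ?case
    proof (intro allI impI)
      fix a :: "'d multi_index \<Rightarrow> complex" and \<alpha>
      assume a: "entire_coeffs a" and 0: "\<forall>z. power_series a z = 0"
        and supp: "\<forall>\<alpha>. a \<alpha> \<noteq> 0 \<longrightarrow> (\<forall>i. i \<notin> insert j I \<longrightarrow> \<alpha> i = 0)"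
      have "power_series (slice j n a) z = 0" for n z
      proof (rule power_series_1_eq_0)
        fix w
        define z' where "z' = (\<chi> i. if i = j then w else z $ i)"
        have eq: "power_series (slice j n a) z' = power_series (slice j n a) z" for n
          by (rule power_series_cong_support[of _ j]) (auto simp: slice_def z'_def split: if_splits)
        show "(\<lambda>n. power_series (slice j n a) z * w ^ n) sums 0"
          using power_series_slices[OF a, of j z'] 0 eq by (simp add: z'_def)
      qed
      moreover have "\<forall>\<beta>. slice j n a \<beta> \<noteq> 0 \<longrightarrow> (\<forall>i. i \<notin> I \<longrightarrow> \<beta> i = 0)" for n
      proof (intro allI impI)
        fix \<beta> i assume \<beta>: "slice j n a \<beta> \<noteq> 0" and i: "i \<notin> I"
        show "\<beta> i = 0"
        proof (cases "i = j")
          case False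
          then have "(\<beta>(j := n)) i = 0" using \<beta> i supp by (auto simp: slice_def split: if_splits)
          then show ?thesis using False by simp
        qed (use \<beta> in \<open>auto simp: slice_def split: if_splits\<close>)
      qed
      ultimately have "slice j n a \<beta> = 0" for n \<beta>
        using insert.IH entire_coeffs_slice[OF a] by blast
      from this[of "\<alpha> j" "\<alpha>(j := 0)"] show "a \<alpha> = 0" by (simp add: slice_def)
    qed
  qed
  from this[OF finite[of UNIV]] show ?thesis using assms by auto
qed

lemma power_series_inj:
  assumes "entire_coeffs a" "entire_coeffs b" "power_series a = power_series b"
  shows "a = b"
proof
  fix \<alpha>
  have ec: "entire_coeffs (\<lambda>\<alpha>. 1 * a \<alpha> + (-1) * b \<alpha>)" by (intro entire_coeffs_lincomb assms)
  have "1 * a \<alpha> + (-1) * b \<alpha> = 0"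
    by (rule power_series_eq_0_imp[OF ec]) (simp only: power_series_lincomb[OF assms(1,2)] assms(3), simp)
  then show "a \<alpha> = b \<alpha>" by simp
qed

section \<open>Taylor expansion of entire functions\<close>

text \<open>This class is what the expansion in one variable after the other needs: it contains the entire
functions, the one-variable theory applies on each line parallel to an axis, and it is visibly
closed under locally uniform limits. That partial derivatives of entire functions are again
entire is a consequence of the expansion that is still to be proved.\<close>

definition sep_holomorphic :: "(complex ^ 'd::finite \<Rightarrow> complex) \<Rightarrow> bool"
  where "sep_holomorphic F \<longleftrightarrow> continuous_on UNIV F \<and> (\<forall>z i. (\<lambda>w. F (z + axis i w)) holomorphic_on UNIV)"

definition pderiv_at :: "'d::finite \<Rightarrow> (complex ^ 'd \<Rightarrow> complex) \<Rightarrow> complex ^ 'd \<Rightarrow> complex"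
  where "pderiv_at j F z = deriv (\<lambda>w. F (z + axis j w)) 0"

lemma axis_add: "axis i (x + y) = axis i x + axis i (y :: 'a::monoid_add)"
  by (simp add: vec_eq_iff axis_def)

lemma axis_zero: "axis i (0 :: 'a::zero) = 0"
  by simp

lemma norm_axis: "norm (axis i (x::complex) :: complex ^ 'd::finite) = cmod x"
proof -
  have "L2_set (\<lambda>k. norm (axis i x $ k)) (UNIV::'d set) = L2_set (\<lambda>k. norm (axis i x $ k)) {i}"
    unfolding L2_set_def by (intro arg_cong[where f = sqrt] sum.mono_neutral_right) (auto simp: axis_def)
  then show ?thesis by (simp add: norm_vec_def)
qed

lemma entire_imp_sep_holomorphic:
  assumes "entire F"
  shows "sep_holomorphic F"
  unfolding sep_holomorphic_def
proof (intro conjI allI)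
  show "continuous_on UNIV F"
    using assms unfolding entire_def
    by (metis continuous_at_imp_continuous_on has_derivative_continuous)
  fix z i
  show "(\<lambda>w. F (z + axis i w)) holomorphic_on UNIV"
    unfolding holomorphic_on_def field_differentiable_def
  proof
    fix w
    obtain D where D: "(F has_derivative D) (at (z + axis i w))" "\<And>a v. D (a *s v) = a * D v"
      using assms unfolding entire_def by blast
    have bl: "bounded_linear (\<lambda>w::complex. axis i w :: complex ^ 'a)"
    proof (rule bounded_linear_intro)
      show "norm (axis i x :: complex ^ 'a) \<le> norm x * 1" for x :: complex by (simp add: norm_axis)
    qed (auto simp: vec_eq_iff axis_def)
    have "((\<lambda>w. z + axis i w) has_derivative (\<lambda>h. axis i h)) (at w)"
      using has_derivative_add[OF has_derivative_const[of z] bounded_linear_imp_has_derivative[OF bl]]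
      by simp
    from has_derivative_compose[OF this D(1)]
    have "((\<lambda>w. F (z + axis i w)) has_derivative (\<lambda>h. D (axis i h))) (at w)" .
    moreover have "D (axis i h) = D (axis i 1) * h" for h
    proof -
      have "axis i h = h *s (axis i 1 :: complex ^ 'a)" by (simp add: vec_eq_iff axis_def)
      then have "D (axis i h) = D (h *s axis i 1)" by (rule arg_cong)
      also have "\<dots> = D (axis i 1) * h" by (simp only: D(2) mult.commute)
      finally show ?thesis .
    qed
    then have "(\<lambda>h. D (axis i h)) = (*) (D (axis i 1))" by (rule ext)
    ultimately have "((\<lambda>w. F (z + axis i w)) has_field_derivative D (axis i 1)) (at w)"
      unfolding has_field_derivative_def by (simp only:)
    then show "\<exists>f'. ((\<lambda>w. F (z + axis i w)) has_field_derivative f') (at w within UNIV)" by blast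
  qed
qed

lemma sep_holomorphic_bounded:
  assumes "sep_holomorphic F"
  obtains M where "M \<ge> 0" "\<And>z. norm z \<le> \<rho> \<Longrightarrow> cmod (F z) \<le> M"
proof -
  have "bounded (F ` cball 0 \<rho>)"
    using assms unfolding sep_holomorphic_def
    by (intro compact_imp_bounded compact_continuous_image) (auto intro: continuous_on_subset)
  then obtain M where "\<forall>x\<in>F ` cball 0 \<rho>. norm x \<le> M" unfolding bounded_iff by blast
  then have "\<And>z. norm z \<le> \<rho> \<Longrightarrow> cmod (F z) \<le> max M 0" by (force simp: le_max_iff_disj)
  then show ?thesis using that[of "max M 0"] by simp
qed

lemma higher_deriv_pderiv_at:
  "(deriv ^^ n) (\<lambda>w. F (z + axis j w)) = (\<lambda>w. (pderiv_at j ^^ n) F (z + axis j w))"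
proof (induction n)
  case (Suc n)
  show ?case
  proof
    fix w
    have "(deriv ^^ Suc n) (\<lambda>w. F (z + axis j w)) w = deriv (\<lambda>w. (pderiv_at j ^^ n) F (z + axis j w)) w"
      by (simp add: Suc.IH)
    also have "\<dots> = (pderiv_at j ^^ Suc n) F (z + axis j w)"
      by (subst deriv_shift_0) (simp add: pderiv_at_def o_def axis_add add.assoc)
    finally show "(deriv ^^ Suc n) (\<lambda>w. F (z + axis j w)) w = (pderiv_at j ^^ Suc n) F (z + axis j w)" .
  qed
qed simp

lemma higher_deriv_at_0: "(deriv ^^ n) (\<lambda>w. F (z + axis j w)) 0 = (pderiv_at j ^^ n) F z"
  by (simp add: higher_deriv_pderiv_at axis_zero)

text \<open>Taylor's formula of order one on the line through \<open>z\<close>: the second derivative on the disc of radius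
\<open>1/2\<close> is at most \<open>2 M / (1/2)\<^sup>2 = 8 M\<close> by Cauchy's inequality on discs of radius \<open>1/2\<close>, which stay
within distance \<open>1\<close> of \<open>z\<close>.\<close>

lemma difference_quotient_pderiv_at:
  assumes F: "sep_holomorphic F" and M: "\<And>y. norm y \<le> \<rho> + 1 \<Longrightarrow> cmod (F y) \<le> M"
    and z: "norm z \<le> \<rho>" and h: "h \<noteq> 0" "cmod h \<le> 1/2"
  shows "cmod ((F (z + axis j h) - F z) / h - pderiv_at j F z) \<le> 8 * M * cmod h"
proof -
  define \<phi> where "\<phi> w = F (z + axis j w)" for w
  have hol: "\<phi> holomorphic_on UNIV" using F unfolding sep_holomorphic_def \<phi>_def by blast
  have \<phi>_le: "cmod (\<phi> w) \<le> M" if "cmod w \<le> 1" for w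
    unfolding \<phi>_def using norm_triangle_ineq[of z "axis j w"] z that
    by (intro M) (simp add: norm_axis)
  have "cmod (\<phi> h - (\<Sum>i\<le>1. (deriv ^^ i) \<phi> 0 * (h - 0) ^ i / fact i)) \<le> 8 * M * cmod (h - 0) ^ Suc 1 / fact 1"
    using h
  proof (intro complex_Taylor[of "cball 0 (1/2)" 1 "\<lambda>i. (deriv ^^ i) \<phi>", simplified funpow_0])
    fix i and x :: complex assume "x \<in> cball 0 (1/2)"
    show "((deriv ^^ i) \<phi> has_field_derivative (deriv ^^ Suc i) \<phi> x) (at x within cball 0 (1/2))"
      using holomorphic_derivI[OF holomorphic_higher_deriv[OF hol], of x i]
      by (auto intro: has_field_derivative_at_within)
  next
    fix x :: complex assume x: "x \<in> cball 0 (1/2)"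
    have "cmod ((deriv ^^ 2) \<phi> x) \<le> fact 2 * M / (1/2) ^ 2"
    proof (rule Cauchy_inequality)
      fix y assume "cmod (x - y) = 1/2"
      then show "cmod (\<phi> y) \<le> M"
        using x norm_triangle_ineq4[of x "x - y"] by (intro \<phi>_le) simp
    qed (auto intro: holomorphic_on_subset[OF hol] continuous_on_subset[OF holomorphic_on_imp_continuous_on[OF hol]])
    then show "cmod ((deriv ^^ Suc 1) \<phi> x) \<le> 8 * M" by (simp add: numeral_2_eq_2)
  qed auto
  then have *: "cmod (\<phi> h - \<phi> 0 - deriv \<phi> 0 * h) \<le> 8 * M * cmod h * cmod h"
    by (simp add: algebra_simps)
  have "(\<phi> h - \<phi> 0) / h - deriv \<phi> 0 = (\<phi> h - \<phi> 0 - deriv \<phi> 0 * h) / h"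
    using h by (simp add: field_simps)
  then have "cmod ((\<phi> h - \<phi> 0) / h - deriv \<phi> 0) = cmod (\<phi> h - \<phi> 0 - deriv \<phi> 0 * h) / cmod h"
    by (simp add: norm_divide)
  also have "\<dots> \<le> 8 * M * cmod h" using * h by (simp add: field_simps)
  finally show ?thesis
    unfolding \<phi>_def pderiv_at_def by (simp add: axis_zero)
qed

text \<open>A partial derivative is the limit of difference quotients, uniformly on bounded sets by the
previous estimate, and each quotient belongs to the class.\<close>

lemma sep_holomorphic_pderiv_at:
  assumes F: "sep_holomorphic (F :: complex ^ 'd::finite \<Rightarrow> complex)"
  shows "sep_holomorphic (pderiv_at j F)"
proof -
  define h :: "nat \<Rightarrow> complex" where "h k = of_real (1 / (real k + 2))" for k
  define g where "g k z = (F (z + axis j (h k)) - F z) / h k" for k z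
  have h0: "h k \<noteq> 0" and h_le: "cmod (h k) \<le> 1/2" for k
    unfolding h_def by (auto simp: field_simps simp del: of_real_divide)
  have lim: "uniform_limit (cball 0 \<rho>) g (pderiv_at j F) sequentially" for \<rho>
  proof (rule uniform_limitI)
    fix \<epsilon> :: real assume "\<epsilon> > 0"
    obtain M where M: "M \<ge> 0" "\<And>y. norm y \<le> \<rho> + 1 \<Longrightarrow> cmod (F y) \<le> M"
      using sep_holomorphic_bounded[OF F] by blast
    have "(\<lambda>k. 8 * M * (1 / (real k + 2))) \<longlonglongrightarrow> 8 * M * 0"
      using LIMSEQ_ignore_initial_segment[OF lim_1_over_n, of 2]
      by (intro tendsto_intros) (simp add: add.commute)
    then have "(\<lambda>k. 8 * M * (1 / (real k + 2))) \<longlonglongrightarrow> 0" by simp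
    from order_tendstoD(2)[OF this \<open>\<epsilon> > 0\<close>]
    show "\<forall>\<^sub>F k in sequentially. \<forall>z\<in>cball 0 \<rho>. dist (g k z) (pderiv_at j F z) < \<epsilon>"
    proof eventually_elim
      case (elim k)
      have "cmod (h k) = 1 / (real k + 2)" unfolding h_def norm_of_real by simp
      then have "dist (g k z) (pderiv_at j F z) \<le> 8 * M * (1 / (real k + 2))" if "z \<in> cball 0 \<rho>" for z
        using difference_quotient_pderiv_at[OF F M(2) _ h0[of k] h_le[of k], where z = z and j = j] that
        unfolding g_def dist_norm by simp
      then show ?case using elim by (meson order_le_less_trans)
    qed
  qed
  have cont: "continuous_on UNIV F" and hol: "\<And>z i. (\<lambda>w. F (z + axis i w)) holomorphic_on UNIV"
    using F unfolding sep_holomorphic_def by blast+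
  have gcont: "continuous_on UNIV (g k)" for k
    unfolding g_def using h0 by (intro continuous_intros continuous_on_compose2[OF cont]) auto
  show ?thesis
    unfolding sep_holomorphic_def
  proof (intro conjI allI)
    show "continuous_on UNIV (pderiv_at j F)"
    proof (rule continuous_at_imp_continuous_on, rule ballI)
      fix z :: "complex ^ 'd"
      have "continuous_on (cball 0 (norm z + 1)) (pderiv_at j F)"
        by (rule uniform_limit_theorem[OF _ lim])
          (auto intro!: always_eventually continuous_on_subset[OF gcont])
      moreover have "z \<in> interior (cball 0 (norm z + 1))" by simp
      ultimately show "isCont (pderiv_at j F) z" by (rule continuous_on_interior)
    qed
    fix z i
    show "(\<lambda>w. pderiv_at j F (z + axis i w)) holomorphic_on UNIV"
    proof (rule holomorphic_uniform_sequence)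
      show "(\<lambda>w. g k (z + axis i w)) holomorphic_on UNIV" for k
      proof -
        have "(\<lambda>w. F (z + axis j (h k) + axis i w)) holomorphic_on UNIV" by (rule hol)
        then show ?thesis unfolding g_def using h0 hol[of z i]
          by (intro holomorphic_intros) (auto simp: add_ac)
      qed
      fix x :: complex
      have "uniform_limit (cball x 1) (\<lambda>k w. g k (z + axis i w)) (\<lambda>w. pderiv_at j F (z + axis i w)) sequentially"
      proof (rule uniform_limitI)
        fix \<epsilon> :: real assume "\<epsilon> > 0"
        from uniform_limitD[OF lim[of "norm z + cmod x + 1"] this]
        show "\<forall>\<^sub>F k in sequentially. \<forall>w\<in>cball x 1.
          dist (g k (z + axis i w)) (pderiv_at j F (z + axis i w)) < \<epsilon>"
        proof eventually_elim
          case (elim k)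
          have "norm (z + axis i w) \<le> norm z + cmod x + 1" if "w \<in> cball x 1" for w
            using norm_triangle_ineq[of z "axis i w"] norm_triangle_sub[of w x] that
            by (simp add: norm_axis dist_norm norm_minus_commute)
          then show ?case using elim by auto
        qed
      qed
      then show "\<exists>d>0. cball x d \<subseteq> UNIV \<and> uniform_limit (cball x d) (\<lambda>k w. g k (z + axis i w))
          (\<lambda>w. pderiv_at j F (z + axis i w)) sequentially"
        by (intro exI[of _ 1]) auto
    qed simp
  qed
qed

lemma norm_le_sum_coordinates: "norm (z :: complex ^ 'd::finite) \<le> (\<Sum>i\<in>UNIV. cmod (z $ i))"
  unfolding norm_vec_def by (rule L2_set_le_sum) auto

text \<open>Cauchy's inequalities on all polycircles in the coordinates \<open>I\<close>, with a separate radius for each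
variable. The coefficient estimate below depends on choosing these radii independently.\<close>

definition cauchy_bounds ::
    "'d set \<Rightarrow> (complex ^ 'd::finite \<Rightarrow> complex) \<Rightarrow> ('d multi_index \<Rightarrow> complex) \<Rightarrow> bool"
  where "cauchy_bounds I F a \<longleftrightarrow> (\<forall>t M. (\<forall>i. t i > 0) \<longrightarrow>
    (\<forall>z. (\<forall>i\<in>I. cmod (z $ i) = t i) \<longrightarrow> (\<forall>i. i \<notin> I \<longrightarrow> z $ i = 0) \<longrightarrow> cmod (F z) \<le> M) \<longrightarrow>
    (\<forall>\<alpha>. cmod (a \<alpha>) * (\<Prod>i\<in>UNIV. t i ^ \<alpha> i) \<le> M))"

lemma cauchy_boundsD:
  assumes "cauchy_bounds I F a" "\<And>i. t i > 0"
    and "\<And>z. \<lbrakk>\<And>i. i \<in> I \<Longrightarrow> cmod (z $ i) = t i; \<And>i. i \<notin> I \<Longrightarrow> z $ i = 0\<rbrakk> \<Longrightarrow> cmod (F z) \<le> M"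
  shows "cmod (a \<alpha>) * (\<Prod>i\<in>UNIV. t i ^ \<alpha> i) \<le> M"
  using assms unfolding cauchy_bounds_def by blast

lemma cauchy_bounds_imp_entire_coeffs:
  fixes F :: "complex ^ 'd::finite \<Rightarrow> complex"
  assumes F: "sep_holomorphic F" and a: "cauchy_bounds I F a"
  shows "entire_coeffs a"
  unfolding entire_coeffs_def
proof (intro allI impI)
  fix t :: real assume t: "t > 0"
  obtain M where M: "\<And>z. norm z \<le> real CARD('d) * t \<Longrightarrow> cmod (F z) \<le> M"
    using sep_holomorphic_bounded[OF F] by blast
  have "cmod (a \<alpha>) * t ^ mi_abs \<alpha> \<le> M" for \<alpha>
    unfolding power_mi_abs
  proof (rule cauchy_boundsD[OF a])
    fix z :: "complex ^ 'd"
    assume "\<And>i. i \<in> I \<Longrightarrow> cmod (z $ i) = t" "\<And>i. i \<notin> I \<Longrightarrow> z $ i = 0"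
    then have "cmod (z $ i) \<le> t" for i using t by (cases "i \<in> I") auto
    then have "(\<Sum>i\<in>UNIV. cmod (z $ i)) \<le> real CARD('d) * t"
      using sum_bounded_above[of UNIV "\<lambda>i. cmod (z $ i)" t] by simp
    then show "cmod (F z) \<le> M"
      using norm_le_sum_coordinates[of z] by (intro M) linarith
  qed (use t in auto)
  then show "\<exists>M. \<forall>\<alpha>. cmod (a \<alpha>) * t ^ mi_abs \<alpha> \<le> M" by blast
qed

lemma
  fixes F :: "complex ^ 'd::finite \<Rightarrow> complex" and j :: 'd
  assumes F: "sep_holomorphic F"
  defines "f \<equiv> \<lambda>n z. (pderiv_at j ^^ n) F z / fact n"
  shows sep_holomorphic_taylor_1: "sep_holomorphic (f n)"
    and taylor_1_sums: "(\<lambda>n. f n z * w ^ n) sums F (z + axis j w)"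
    and taylor_1_le: "\<lbrakk>t > 0; \<And>w. cmod w = t \<Longrightarrow> cmod (F (z + axis j w)) \<le> M\<rbrakk> \<Longrightarrow> cmod (f n z) * t ^ n \<le> M"
proof -
  have "sep_holomorphic ((pderiv_at j ^^ n) F)"
    by (induction n) (simp_all add: F sep_holomorphic_pderiv_at)
  then show "sep_holomorphic (f n)"
    unfolding sep_holomorphic_def f_def by (auto intro!: continuous_intros holomorphic_intros)
  have hol: "(\<lambda>w. F (z + axis j w)) holomorphic_on UNIV"
    using F unfolding sep_holomorphic_def by blast
  show "(\<lambda>n. f n z * w ^ n) sums F (z + axis j w)"
    using holomorphic_power_series[of "\<lambda>w. F (z + axis j w)" 0 "cmod w + 1" w]
    by (simp add: f_def higher_deriv_at_0 holomorphic_on_subset[OF hol])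
  show "cmod (f n z) * t ^ n \<le> M" if "t > 0" "\<And>w. cmod w = t \<Longrightarrow> cmod (F (z + axis j w)) \<le> M"
  proof -
    have "cmod ((deriv ^^ n) (\<lambda>w. F (z + axis j w)) 0) \<le> fact n * M / t ^ n"
      using that
      by (intro Cauchy_inequality)
        (auto intro: holomorphic_on_subset[OF hol] continuous_on_subset[OF holomorphic_on_imp_continuous_on[OF hol]])
    then show ?thesis
      using that by (simp add: f_def higher_deriv_at_0 norm_divide field_simps)
  qed
qed

text \<open>Induction on \<open>I\<close>. Expand \<open>F\<close> in the new variable \<open>j\<close>, expand each of its coefficient functions in
the old variables, and let the resulting families be the slices of one family \<open>a\<close>. Cauchy's
inequality in the variable \<open>j\<close> followed by those for the coefficient functions bounds \<open>a\<close>; these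
bounds make the multiple series converge absolutely, so that it may be summed slice by slice,
and there it gives back \<open>F\<close>.\<close>

lemma taylor_expansion_on_coordinates:
  fixes F :: "complex ^ 'd::finite \<Rightarrow> complex"
  assumes "finite I" "sep_holomorphic F"
  shows "\<exists>a. (\<forall>\<alpha>. a \<alpha> \<noteq> 0 \<longrightarrow> (\<forall>i. i \<notin> I \<longrightarrow> \<alpha> i = 0)) \<and> cauchy_bounds I F a \<and>
    (\<forall>z. (\<forall>i. i \<notin> I \<longrightarrow> z $ i = 0) \<longrightarrow> F z = power_series a z)"
  using assms
proof (induction I arbitrary: F rule: finite_induct)
  case (empty F)
  define a :: "'d multi_index \<Rightarrow> complex" where "a \<alpha> = (if \<alpha> = (\<lambda>_. 0) then F 0 else 0)" for \<alpha>
  have 0: "z = 0" if "\<forall>i. i \<notin> {} \<longrightarrow> z $ i = 0" for z :: "complex ^ 'd"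
    using that by (simp add: vec_eq_iff)
  have "power_series a z = a (\<lambda>_. 0)" for z
    by (rule power_series_at_constant) (simp add: a_def split: if_splits)
  then have "F z = power_series a z" if "\<forall>i. i \<notin> {} \<longrightarrow> z $ i = 0" for z
    using 0[OF that] by (simp add: a_def)
  moreover have "cauchy_bounds {} F a"
    unfolding cauchy_bounds_def
  proof (intro allI impI)
    fix t :: "'d \<Rightarrow> real" and M \<alpha>
    assume "\<forall>z. (\<forall>i\<in>{}. cmod (z $ i) = t i) \<longrightarrow> (\<forall>i. i \<notin> {} \<longrightarrow> z $ i = 0) \<longrightarrow> cmod (F z) \<le> M"
    then have "cmod (F 0) \<le> M" by simp
    then have "cmod (F 0) \<le> M" "0 \<le> M" using norm_ge_zero[of "F 0"] by linarith+
    then show "cmod (a \<alpha>) * (\<Prod>i\<in>UNIV. t i ^ \<alpha> i) \<le> M" by (auto simp: a_def)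
  qed
  moreover have "\<forall>\<alpha>. a \<alpha> \<noteq> 0 \<longrightarrow> (\<forall>i. i \<notin> {} \<longrightarrow> \<alpha> i = 0)" by (auto simp: a_def)
  ultimately show ?case by blast
next
  case (insert j I F)
  define f where "f n z = (pderiv_at j ^^ n) F z / fact n" for n z
  have f_holo: "sep_holomorphic (f n)" for n
    unfolding f_def by (rule sep_holomorphic_taylor_1[OF insert.prems])
  have f_sums: "(\<lambda>n. f n z * w ^ n) sums F (z + axis j w)" for z w
    unfolding f_def by (rule taylor_1_sums[OF insert.prems])
  have f_le: "cmod (f n z) * t ^ n \<le> M"
    if "t > 0" "\<And>w. cmod w = t \<Longrightarrow> cmod (F (z + axis j w)) \<le> M" for n z t M
    unfolding f_def using that by (rule taylor_1_le[OF insert.prems])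
  have "\<forall>n. \<exists>a. (\<forall>\<alpha>. a \<alpha> \<noteq> 0 \<longrightarrow> (\<forall>i. i \<notin> I \<longrightarrow> \<alpha> i = 0)) \<and> cauchy_bounds I (f n) a \<and>
    (\<forall>z. (\<forall>i. i \<notin> I \<longrightarrow> z $ i = 0) \<longrightarrow> f n z = power_series a z)"
    using insert.IH f_holo by blast
  then obtain A where A_supp: "\<And>n \<alpha> i. \<lbrakk>A n \<alpha> \<noteq> 0; i \<notin> I\<rbrakk> \<Longrightarrow> \<alpha> i = 0"
    and A_cauchy: "\<And>n. cauchy_bounds I (f n) (A n)"
    and A_sum: "\<And>n z. \<lbrakk>\<And>i. i \<notin> I \<Longrightarrow> z $ i = 0\<rbrakk> \<Longrightarrow> f n z = power_series (A n) z"
    by metis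
  define a where "a \<alpha> = A (\<alpha> j) (\<alpha>(j := 0))" for \<alpha>
  have slice: "slice j n a = A n" for n
  proof
    fix \<beta> :: "'d multi_index"
    have "\<beta>(j := 0) = \<beta>" if "\<beta> j = 0" using that by auto
    then show "slice j n a \<beta> = A n \<beta>"
      using A_supp[of n \<beta> j] insert.hyps by (cases "A n \<beta> = 0") (auto simp: slice_def a_def)
  qed
  have supp: "\<alpha> i = 0" if "a \<alpha> \<noteq> 0" "i \<notin> insert j I" for \<alpha> i
    using A_supp[of "\<alpha> j" "\<alpha>(j := 0)" i] that by (auto simp: a_def)
  have cauchy: "cauchy_bounds (insert j I) F a"
    unfolding cauchy_bounds_def
  proof (intro allI impI)
    fix t :: "'d \<Rightarrow> real" and M \<alpha>
    assume t: "\<forall>i. t i > 0"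
      and M: "\<forall>z. (\<forall>i\<in>insert j I. cmod (z $ i) = t i) \<longrightarrow> (\<forall>i. i \<notin> insert j I \<longrightarrow> z $ i = 0) \<longrightarrow> cmod (F z) \<le> M"
    have "cmod (A (\<alpha> j) (\<alpha>(j := 0))) * (\<Prod>i\<in>UNIV. t i ^ (\<alpha>(j := 0)) i) \<le> M / t j ^ \<alpha> j"
    proof (rule cauchy_boundsD[OF A_cauchy])
      fix z :: "complex ^ 'd"
      assume z: "\<And>i. i \<in> I \<Longrightarrow> cmod (z $ i) = t i" "\<And>i. i \<notin> I \<Longrightarrow> z $ i = 0"
      have "cmod (f (\<alpha> j) z) * t j ^ \<alpha> j \<le> M"
      proof (rule f_le)
        fix w assume "cmod w = t j"
        then show "cmod (F (z + axis j w)) \<le> M"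
          using z insert.hyps by (intro M[rule_format]) (auto simp: axis_def)
      qed (use t in auto)
      then show "cmod (f (\<alpha> j) z) \<le> M / t j ^ \<alpha> j" using t by (simp add: field_simps)
    qed (use t in auto)
    then show "cmod (a \<alpha>) * (\<Prod>i\<in>UNIV. t i ^ \<alpha> i) \<le> M"
      unfolding a_def prod_power_split_coordinate[of t \<alpha> j] using t by (simp add: field_simps)
  qed
  have ec: "entire_coeffs a" by (rule cauchy_bounds_imp_entire_coeffs[OF insert.prems cauchy])
  have "F z = power_series a z" if z: "\<And>i. i \<notin> insert j I \<Longrightarrow> z $ i = 0" for z
  proof -
    \<comment> \<open>The projection of \<open>z\<close> to the old variables, where the induction hypothesis applies.\<close>
    define z0 where "z0 = z - axis j (z $ j)"
    have z0_nth: "z0 $ i = (if i = j then 0 else z $ i)" for i by (simp add: z0_def axis_def)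
    have "f n z0 = power_series (slice j n a) z" for n
    proof -
      have "f n z0 = power_series (A n) z0" using z by (intro A_sum) (auto simp: z0_nth)
      also have "\<dots> = power_series (A n) z"
        by (rule power_series_cong_support[of _ j]) (use A_supp insert.hyps in \<open>auto simp: z0_nth\<close>)
      finally show ?thesis by (simp add: slice)
    qed
    then have "(\<lambda>n. power_series (slice j n a) z * (z $ j) ^ n) sums F z"
      using f_sums[of z0 "z $ j"] by (simp add: z0_def)
    from sums_unique2[OF this power_series_slices[OF ec]] show ?thesis .
  qed
  then show ?case using supp cauchy by blast
qed

definition taylor :: "(complex ^ 'd::finite \<Rightarrow> complex) \<Rightarrow> 'd multi_index \<Rightarrow> complex"
  where "taylor = inv_into (Collect entire_coeffs) power_series"

lemma taylor_power_series: "entire_coeffs a \<Longrightarrow> taylor (power_series a) = a"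
  unfolding taylor_def
  by (rule inv_into_f_f) (auto intro: inj_onI power_series_inj)

lemma
  fixes F :: "complex ^ 'd::finite \<Rightarrow> complex"
  assumes "entire F"
  shows entire_coeffs_taylor: "entire_coeffs (taylor F)"
    and power_series_taylor: "power_series (taylor F) = F"
    and Cauchy_inequality_taylor: "\<lbrakk>\<And>i. t i > 0; \<And>z. (\<And>i. cmod (z $ i) = t i) \<Longrightarrow> cmod (F z) \<le> M\<rbrakk>
      \<Longrightarrow> cmod (taylor F \<alpha>) * (\<Prod>i\<in>UNIV. t i ^ \<alpha> i) \<le> M"
proof -
  have F: "sep_holomorphic F" by (rule entire_imp_sep_holomorphic[OF assms])
  obtain a where a: "cauchy_bounds UNIV F a" "\<And>z. F z = power_series a z"
    using taylor_expansion_on_coordinates[OF finite[of UNIV] F] by auto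
  have ec: "entire_coeffs a" by (rule cauchy_bounds_imp_entire_coeffs[OF F a(1)])
  have "F = power_series a" using a(2) by auto
  then have taylor: "taylor F = a" using taylor_power_series[OF ec] by simp
  show "entire_coeffs (taylor F)" "power_series (taylor F) = F"
    using ec by (simp_all only: taylor \<open>F = power_series a\<close>[symmetric])
  show "cmod (taylor F \<alpha>) * (\<Prod>i\<in>UNIV. t i ^ \<alpha> i) \<le> M"
    if "\<And>i. t i > 0" "\<And>z. (\<And>i. cmod (z $ i) = t i) \<Longrightarrow> cmod (F z) \<le> M"
    unfolding taylor using cauchy_boundsD[OF a(1) that(1)] that(2) by simp
qed

section \<open>Weighted sequence spaces\<close>

text \<open>The quasi-norm controls the supremum. Conversely, by the lemma on geometric decay below, the supremum
controls the quasi-norm once a geometric factor is given away. Changing \<open>r\<close> provides such factors, hence the independence of the limits from \<open>p\<close>.\<close>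

lemma norm_le_lp_norm:
  assumes "0 < p" "c \<in> lp_set p \<theta>"
  shows "cmod (c \<alpha> * \<theta> \<alpha>) \<le> lp_norm p \<theta> c"
proof (cases "p = \<infinity>")
  case True
  then show ?thesis using assms by (auto simp: lp_set_def lp_norm_def intro: cSUP_upper)
next
  case False
  define q where "q = real_of_ereal p"
  have q: "q > 0" using assms(1) False unfolding q_def by (cases p) auto
  let ?f = "\<lambda>\<alpha>. cmod (c \<alpha> * \<theta> \<alpha>) powr q"
  have sm: "?f summable_on UNIV" using assms(2) False by (simp add: lp_set_def q_def)
  have "?f \<alpha> \<le> infsum ?f UNIV"
    using finite_sum_le_infsum[OF sm, of "{\<alpha>}"] by simp
  then have "?f \<alpha> powr (1 / q) \<le> infsum ?f UNIV powr (1 / q)"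
    using q by (intro powr_mono2) auto
  then show ?thesis using q False by (simp add: powr_powr lp_norm_def q_def[symmetric])
qed

lemma lp_set_diff:
  assumes "0 < p" "c \<in> lp_set p \<theta>" "c' \<in> lp_set p \<theta>"
  shows "(\<lambda>\<alpha>. c \<alpha> - c' \<alpha>) \<in> lp_set p \<theta>"
proof (cases "p = \<infinity>")
  case True
  then obtain M M' where M: "\<And>\<alpha>. cmod (c \<alpha> * \<theta> \<alpha>) \<le> M" "\<And>\<alpha>. cmod (c' \<alpha> * \<theta> \<alpha>) \<le> M'"
    using assms by (auto simp: lp_set_def bdd_above_def)
  have "cmod ((c \<alpha> - c' \<alpha>) * \<theta> \<alpha>) \<le> M + M'" for \<alpha>
    using M[of \<alpha>] norm_triangle_ineq4[of "c \<alpha> * \<theta> \<alpha>" "c' \<alpha> * \<theta> \<alpha>"] by (simp add: left_diff_distrib)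
  then show ?thesis using True by (auto simp: lp_set_def bdd_above_def)
next
  case False
  define q where "q = real_of_ereal p"
  have q: "q > 0" using assms(1) False unfolding q_def by (cases p) auto
  have "(\<lambda>\<alpha>. cmod ((c \<alpha> - c' \<alpha>) * \<theta> \<alpha>) powr q) summable_on UNIV"
  proof (rule summable_on_comparison_test)
    show "(\<lambda>\<alpha>. 2 powr q * (cmod (c \<alpha> * \<theta> \<alpha>) powr q + cmod (c' \<alpha> * \<theta> \<alpha>) powr q)) summable_on UNIV"
      using assms False by (intro summable_on_cmult_right summable_on_add) (auto simp: lp_set_def q_def)
    fix \<alpha>
    let ?x = "cmod (c \<alpha> * \<theta> \<alpha>)" and ?y = "cmod (c' \<alpha> * \<theta> \<alpha>)"
    have "cmod ((c \<alpha> - c' \<alpha>) * \<theta> \<alpha>) \<le> ?x + ?y"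
      using norm_triangle_ineq4[of "c \<alpha> * \<theta> \<alpha>" "c' \<alpha> * \<theta> \<alpha>"] by (simp add: left_diff_distrib)
    also have "\<dots> \<le> 2 * max ?x ?y" by simp
    finally have "cmod ((c \<alpha> - c' \<alpha>) * \<theta> \<alpha>) powr q \<le> (2 * max ?x ?y) powr q"
      using q by (intro powr_mono2) auto
    also have "\<dots> = 2 powr q * max ?x ?y powr q" by (simp add: powr_mult le_max_iff_disj)
    also have "\<dots> \<le> 2 powr q * (?x powr q + ?y powr q)"
      by (intro mult_left_mono) (auto simp: max_def)
    finally show "cmod ((c \<alpha> - c' \<alpha>) * \<theta> \<alpha>) powr q \<le> 2 powr q * (?x powr q + ?y powr q)" .
  qed auto
  then show ?thesis using False by (simp add: lp_set_def q_def)
qed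

text \<open>The constant depends on \<open>p\<close> and the dimension only, since all weights are compared with the single
summable family \<open>(1/2) ^ |\<alpha>|\<close>.\<close>

lemma geometric_decay_imp_lp:
  assumes "0 < p"
  obtains K where "K > 0"
    and "\<And>(c :: 'd::finite multi_index \<Rightarrow> complex) \<theta> M. (\<And>\<alpha>. cmod (c \<alpha> * \<theta> \<alpha>) \<le> M * (1/2) ^ mi_abs \<alpha>) \<Longrightarrow>
      c \<in> lp_set p \<theta> \<and> lp_norm p \<theta> c \<le> K * M"
proof (cases "p = \<infinity>")
  case True
  have bound: "c \<in> lp_set p \<theta> \<and> lp_norm p \<theta> c \<le> 1 * M"
    if c: "\<And>\<alpha>. cmod (c \<alpha> * \<theta> \<alpha>) \<le> M * (1/2) ^ mi_abs \<alpha>" for c :: "'d multi_index \<Rightarrow> complex" and \<theta> M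
  proof -
    have "0 \<le> M" using order_trans[OF norm_ge_zero c[of "\<lambda>_. 0"]] by (simp add: mi_abs_def)
    have "cmod (c \<alpha> * \<theta> \<alpha>) \<le> M" for \<alpha>
    proof -
      have "M * (1/2) ^ mi_abs \<alpha> \<le> M * 1"
        using \<open>0 \<le> M\<close> by (intro mult_left_mono power_le_one) auto
      then show ?thesis using c[of \<alpha>] by simp
    qed
    then show ?thesis
      using True by (auto simp: lp_set_def lp_norm_def bdd_above_def intro!: cSUP_least)
  qed
  show ?thesis by (rule that[OF zero_less_one bound])
next
  case False
  define q where "q = real_of_ereal p"
  have q: "q > 0" using assms(1) False unfolding q_def by (cases p) auto
  define x where "x = (1/2) powr q"
  have x: "0 \<le> x" "x < 1"
    unfolding x_def using q powr_less_mono2[of q "1/2" 1] by auto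
  define G where "G = (\<Sum>\<^sub>\<infinity>\<alpha>::'d multi_index. x ^ mi_abs \<alpha>)"
  have sm: "(\<lambda>\<alpha>::'d multi_index. x ^ mi_abs \<alpha>) summable_on UNIV"
    by (rule summable_on_geometric_mi[OF x])
  have G: "G \<ge> 0" unfolding G_def using x by (intro infsum_nonneg) auto
  have bound: "c \<in> lp_set p \<theta> \<and> lp_norm p \<theta> c \<le> (G powr (1 / q) + 1) * M"
    if c: "\<And>\<alpha>. cmod (c \<alpha> * \<theta> \<alpha>) \<le> M * (1/2) ^ mi_abs \<alpha>" for c :: "'d multi_index \<Rightarrow> complex" and \<theta> M
  proof -
    have M: "0 \<le> M" using order_trans[OF norm_ge_zero c[of "\<lambda>_. 0"]] by (simp add: mi_abs_def)
    have le: "cmod (c \<alpha> * \<theta> \<alpha>) powr q \<le> M powr q * x ^ mi_abs \<alpha>" for \<alpha>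
    proof -
      have "cmod (c \<alpha> * \<theta> \<alpha>) powr q \<le> (M * (1/2) ^ mi_abs \<alpha>) powr q"
        using c q by (intro powr_mono2) auto
      also have "\<dots> = M powr q * ((1/2) powr real (mi_abs \<alpha>)) powr q"
        using M by (simp add: powr_mult powr_realpow)
      also have "((1/2::real) powr real (mi_abs \<alpha>)) powr q = x powr real (mi_abs \<alpha>)"
        unfolding x_def by (simp add: powr_powr mult.commute)
      also have "\<dots> = x ^ mi_abs \<alpha>" unfolding x_def by (simp add: powr_realpow)
      finally show ?thesis .
    qed
    have sm': "(\<lambda>\<alpha>. M powr q * x ^ mi_abs \<alpha>) summable_on (UNIV :: 'd multi_index set)"
      by (intro summable_on_cmult_right sm)
    have sm'': "(\<lambda>\<alpha>. cmod (c \<alpha> * \<theta> \<alpha>) powr q) summable_on UNIV"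
      by (rule summable_on_comparison_test[OF sm' le]) auto
    have "(\<Sum>\<^sub>\<infinity>\<alpha>. cmod (c \<alpha> * \<theta> \<alpha>) powr q) \<le> (\<Sum>\<^sub>\<infinity>\<alpha>::'d multi_index. M powr q * x ^ mi_abs \<alpha>)"
      by (rule infsum_mono[OF sm'' sm' le])
    also have "\<dots> = M powr q * G" unfolding G_def by (simp add: infsum_cmult_right')
    finally have "(\<Sum>\<^sub>\<infinity>\<alpha>. cmod (c \<alpha> * \<theta> \<alpha>) powr q) powr (1 / q) \<le> (M powr q * G) powr (1 / q)"
      using q by (intro powr_mono2) (auto intro: infsum_nonneg)
    also have "\<dots> = M * G powr (1 / q)" using q M G by (simp add: powr_mult powr_powr)
    also have "\<dots> \<le> (G powr (1 / q) + 1) * M" using M by (simp add: algebra_simps)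
    finally show ?thesis using False sm'' by (simp add: lp_set_def lp_norm_def q_def)
  qed
  show ?thesis by (rule that[OF _ bound]) (simp add: add_nonneg_pos)
qed

section \<open>Growth against coefficient decay\<close>

text \<open>All weights of the theorem have this form: \<open>\<tau> = 1 / (2 \<sigma>)\<close> with \<open>R = r\<close> for finite \<open>\<sigma>\<close>, and \<open>\<tau> = 0\<close> with
\<open>R = exp r\<close> for \<open>\<sigma> = \<infinity>\<close>.\<close>

definition factorial_weight :: "real \<Rightarrow> real \<Rightarrow> 'd::finite multi_index \<Rightarrow> real"
  where "factorial_weight R \<tau> \<alpha> = R ^ mi_abs \<alpha> * mi_fact \<alpha> powr \<tau>"

lemma mi_fact_pos: "mi_fact \<alpha> > 0"
  unfolding mi_fact_def by (intro prod_pos) auto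

lemma mi_fact_powr: "mi_fact \<alpha> powr \<rho> = (\<Prod>i\<in>UNIV. fact (\<alpha> i) powr \<rho>)"
  unfolding mi_fact_def by (rule prod_powr_distrib)

lemma power_le_fact_mult_exp:
  fixes y :: real
  assumes "y \<ge> 0"
  shows "y ^ n \<le> fact n * exp y"
proof -
  have "(\<lambda>n. y ^ n /\<^sub>R fact n) sums exp y" by (rule exp_converges)
  then have "y ^ n /\<^sub>R fact n \<le> exp y"
    using sum_le_suminf[of "\<lambda>n. y ^ n /\<^sub>R fact n" "{n}"] assms by (simp add: sums_iff)
  then show ?thesis by (simp add: field_simps)
qed

text \<open>This is \<open>y ^ n \<le> n! exp y\<close> raised to the power \<open>\<rho>\<close>, with \<open>y ^ \<rho> = x\<close>. It trades the power \<open>\<rho>\<close> of the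
factorial for the growth exponent \<open>1 / \<rho>\<close>.\<close>

lemma power_le_fact_powr_exp:
  fixes x :: real
  assumes "x \<ge> 0" "\<rho> > 0"
  shows "x ^ n \<le> fact n powr \<rho> * exp (\<rho> * x powr (1 / \<rho>))"
proof (cases "x = 0")
  case True
  then show ?thesis by (cases n) auto
next
  case False
  then have x: "x > 0" using assms by simp
  define y where "y = x powr (1 / \<rho>)"
  have y: "y > 0" unfolding y_def using x by simp
  have "x ^ n = x powr real n" using x by (simp add: powr_realpow)
  also have "\<dots> = (y powr real n) powr \<rho>" unfolding y_def using assms by (simp add: powr_powr)
  also have "\<dots> = (y ^ n) powr \<rho>" using y by (simp add: powr_realpow)
  also have "\<dots> \<le> (fact n * exp y) powr \<rho>"
    using y assms by (intro powr_mono2 power_le_fact_mult_exp) auto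
  also have "\<dots> = fact n powr \<rho> * exp (\<rho> * y)"
    by (simp add: powr_mult exp_powr_real mult.commute)
  finally show ?thesis unfolding y_def .
qed

lemma prod_power_le_mi_fact_powr_exp:
  fixes x :: "'d::finite \<Rightarrow> real"
  assumes "\<And>i. x i \<ge> 0" "\<And>i. x i \<le> y" "\<rho> > 0"
  shows "(\<Prod>i\<in>UNIV. x i ^ \<alpha> i) \<le> mi_fact \<alpha> powr \<rho> * exp (real CARD('d) * \<rho> * y powr (1 / \<rho>))"
proof -
  have "(\<Prod>i\<in>UNIV. x i ^ \<alpha> i) \<le> (\<Prod>i\<in>UNIV. fact (\<alpha> i) powr \<rho> * exp (\<rho> * y powr (1 / \<rho>)))"
  proof (intro prod_mono conjI)
    fix i
    have "x i ^ \<alpha> i \<le> fact (\<alpha> i) powr \<rho> * exp (\<rho> * x i powr (1 / \<rho>))"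
      using assms by (intro power_le_fact_powr_exp)
    also have "\<dots> \<le> fact (\<alpha> i) powr \<rho> * exp (\<rho> * y powr (1 / \<rho>))"
      using assms by (intro mult_left_mono) (auto intro!: powr_mono2)
    finally show "x i ^ \<alpha> i \<le> fact (\<alpha> i) powr \<rho> * exp (\<rho> * y powr (1 / \<rho>))" .
  qed (use assms in auto)
  also have "\<dots> = mi_fact \<alpha> powr \<rho> * exp (\<rho> * y powr (1 / \<rho>)) ^ CARD('d)"
    by (simp add: prod.distrib mi_fact_powr)
  also have "exp (\<rho> * y powr (1 / \<rho>)) ^ CARD('d) = exp (real CARD('d) * \<rho> * y powr (1 / \<rho>))"
    by (simp add: exp_of_nat_mult mult.assoc)
  finally show ?thesis .
qed

text \<open>Passage from coefficients with respect to the orthonormal functions \<open>z^\<alpha> / sqrt (\<alpha>!)\<close> to those with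
respect to monomials. It shifts the exponent of the factorial from \<open>\<tau>\<close> to \<open>\<tau> + 1/2\<close>.\<close>

definition normalize_coeffs :: "'d::finite formal_series \<Rightarrow> 'd multi_index \<Rightarrow> complex"
  where "normalize_coeffs c \<alpha> = c \<alpha> / of_real (sqrt (mi_fact \<alpha>))"

text \<open>The trade-off is applied at \<open>2 |z $ i| / R\<close> instead of \<open>|z $ i| / R\<close>: the factor \<open>2\<close> is what leaves
\<open>(1/2) ^ |\<alpha>|\<close> over, so that the bound can be summed.\<close>

lemma norm_series_term_le:
  fixes c :: "'d::finite formal_series"
  assumes "R > 0" "\<tau> \<ge> 0" and c: "\<And>\<alpha>. cmod (c \<alpha> * factorial_weight R \<tau> \<alpha>) \<le> M"
  defines "\<rho> \<equiv> \<tau> + 1/2"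
  shows "cmod (normalize_coeffs c \<alpha> * monomial \<alpha> z) \<le>
    M * exp (real CARD('d) * \<rho> * (2 / R * norm z) powr (1 / \<rho>)) * (1/2) ^ mi_abs \<alpha>"
proof -
  let ?F = "mi_fact \<alpha>" and ?E = "exp (real CARD('d) * \<rho> * (2 / R * norm z) powr (1 / \<rho>))"
  have F: "?F > 0" by (rule mi_fact_pos)
  have \<rho>: "\<rho> > 0" using assms unfolding \<rho>_def by simp
  have "cmod (c \<alpha>) * (R ^ mi_abs \<alpha> * ?F powr \<tau>) \<le> M"
    using c[of \<alpha>] assms(1) F by (simp add: norm_mult norm_power factorial_weight_def)
  then have c': "cmod (c \<alpha>) * R ^ mi_abs \<alpha> * ?F powr \<tau> \<le> M" by (simp add: mult.assoc)
  have "(\<Prod>i\<in>UNIV. (2 / R * cmod (z $ i)) ^ \<alpha> i) \<le> ?F powr \<rho> * ?E"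
    using assms(1) \<rho> by (intro prod_power_le_mi_fact_powr_exp) (auto intro!: mult_left_mono divide_right_mono Finite_Cartesian_Product.norm_nth_le)
  also have "(\<Prod>i\<in>UNIV. (2 / R * cmod (z $ i)) ^ \<alpha> i) = (2 / R) ^ mi_abs \<alpha> * cmod (monomial \<alpha> z)"
    by (simp only: power_mult_distrib prod.distrib power_mi_abs monomial_def norm_power prod_norm[symmetric])
  finally have mon: "cmod (monomial \<alpha> z) \<le> (R / 2) ^ mi_abs \<alpha> * (?F powr \<rho> * ?E)"
    using assms(1) by (simp add: power_divide field_simps)
  have "?F powr \<rho> = ?F powr \<tau> * sqrt ?F"
    using F by (simp add: \<rho>_def powr_add powr_half_sqrt)
  then have "cmod (normalize_coeffs c \<alpha> * monomial \<alpha> z) \<le>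
      cmod (c \<alpha>) / sqrt ?F * ((R / 2) ^ mi_abs \<alpha> * (?F powr \<tau> * sqrt ?F * ?E))"
    using mon F unfolding normalize_coeffs_def norm_mult norm_divide
    by (intro mult_mono) auto
  also have "\<dots> = (cmod (c \<alpha>) * R ^ mi_abs \<alpha> * ?F powr \<tau>) * (?E * (1/2) ^ mi_abs \<alpha>)"
    using F by (simp add: power_divide)
  also have "\<dots> \<le> M * (?E * (1/2) ^ mi_abs \<alpha>)"
    by (intro mult_right_mono c') auto
  finally show ?thesis by (simp add: mult.assoc)
qed

lemma entire_coeffs_normalize:
  fixes c :: "'d::finite formal_series"
  assumes "R > 0" "\<tau> \<ge> 0" and c: "\<And>\<alpha>. cmod (c \<alpha> * factorial_weight R \<tau> \<alpha>) \<le> M"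
  shows "entire_coeffs (normalize_coeffs c)"
  unfolding entire_coeffs_def
proof (intro allI impI)
  fix t :: real assume t: "t > 0"
  let ?z = "(\<chi> i. of_real t) :: complex ^ 'd"
  let ?E = "exp (real CARD('d) * (\<tau> + 1/2) * (2 / R * norm ?z) powr (1 / (\<tau> + 1/2)))"
  have M0: "0 \<le> M" using order_trans[OF norm_ge_zero c] .
  have "cmod (normalize_coeffs c \<alpha>) * t ^ mi_abs \<alpha> \<le> M * ?E" for \<alpha>
  proof -
    have "monomial \<alpha> ?z = of_real (t ^ mi_abs \<alpha>)" by (simp add: monomial_def power_mi_abs)
    then have "cmod (normalize_coeffs c \<alpha>) * t ^ mi_abs \<alpha> = cmod (normalize_coeffs c \<alpha> * monomial \<alpha> ?z)"
      using t by (simp add: norm_mult norm_power)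
    also have "\<dots> \<le> M * ?E * (1/2) ^ mi_abs \<alpha>" by (rule norm_series_term_le[OF assms])
    also have "\<dots> \<le> M * ?E * 1" using M0 by (intro mult_left_mono power_le_one) auto
    finally show ?thesis by simp
  qed
  then show "\<exists>M. \<forall>\<alpha>. cmod (normalize_coeffs c \<alpha>) * t ^ mi_abs \<alpha> \<le> M" by blast
qed

text \<open>The type of the growth, \<open>d (2 / R) ^ \<kappa> / \<kappa>\<close>, is finite for every \<open>R\<close> and tends to \<open>0\<close> as \<open>R\<close> grows.\<close>

lemma growth_of_series_map:
  fixes c :: "'d::finite formal_series"
  assumes "R > 0" "\<tau> \<ge> 0" and c: "\<And>\<alpha>. cmod (c \<alpha> * factorial_weight R \<tau> \<alpha>) \<le> M"
    and \<kappa>: "\<kappa> = 1 / (\<tau> + 1/2)" and r: "real CARD('d) / \<kappa> * (2 / R) powr \<kappa> \<le> r"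
  shows "cmod (power_series (normalize_coeffs c) z) \<le>
    (\<Sum>\<^sub>\<infinity>\<alpha>::'d multi_index. (1/2) ^ mi_abs \<alpha>) * M * exp (r * norm z powr \<kappa>)"
proof -
  have \<rho>: "\<tau> + 1/2 = 1 / \<kappa>" "1 / (\<tau> + 1/2) = \<kappa>" using \<kappa> assms(2) by auto
  have M0: "0 \<le> M" using order_trans[OF norm_ge_zero c] .
  let ?G = "(\<Sum>\<^sub>\<infinity>\<alpha>::'d multi_index. (1/2) ^ mi_abs \<alpha>) :: real"
  let ?E = "exp (r * norm z powr \<kappa>)"
  have le: "cmod (normalize_coeffs c \<alpha> * monomial \<alpha> z) \<le> M * ?E * (1/2) ^ mi_abs \<alpha>" for \<alpha>
  proof -
    have "real CARD('d) * (\<tau> + 1/2) * (2 / R * norm z) powr (1 / (\<tau> + 1/2))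
        = (real CARD('d) / \<kappa> * (2 / R) powr \<kappa>) * norm z powr \<kappa>"
      unfolding \<rho> powr_mult by simp
    also have "\<dots> \<le> r * norm z powr \<kappa>" by (intro mult_right_mono r) auto
    finally have "M * exp (real CARD('d) * (\<tau> + 1/2) * (2 / R * norm z) powr (1 / (\<tau> + 1/2))) * (1/2) ^ mi_abs \<alpha>
      \<le> M * ?E * (1/2) ^ mi_abs \<alpha>"
      using M0 by (intro mult_right_mono mult_left_mono) auto
    with norm_series_term_le[OF assms(1-3), of \<alpha> z] show ?thesis by linarith
  qed
  have sm: "(\<lambda>\<alpha>::'d multi_index. M * ?E * (1/2) ^ mi_abs \<alpha>) summable_on UNIV"
    by (intro summable_on_cmult_right summable_on_geometric_mi) auto
  have ec: "entire_coeffs (normalize_coeffs c)" by (rule entire_coeffs_normalize[OF assms(1-3)])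
  have "cmod (power_series (normalize_coeffs c) z) \<le> (\<Sum>\<^sub>\<infinity>\<alpha>. cmod (normalize_coeffs c \<alpha> * monomial \<alpha> z))"
    unfolding power_series_def by (rule norm_infsum_bound) (rule entire_coeffs_summable[OF ec])
  also have "\<dots> \<le> (\<Sum>\<^sub>\<infinity>\<alpha>::'d multi_index. M * ?E * (1/2) ^ mi_abs \<alpha>)"
    by (rule infsum_mono[OF entire_coeffs_summable[OF ec] sm le])
  also have "\<dots> = ?G * M * ?E" by (subst infsum_cmult_right') simp
  finally show ?thesis .
qed

lemma sum_powr_le:
  fixes t :: "'d::finite \<Rightarrow> real"
  assumes "\<And>i. t i \<ge> 0" "\<kappa> > 0"
  shows "(\<Sum>i\<in>UNIV. t i) powr \<kappa> \<le> real CARD('d) powr \<kappa> * (\<Sum>i\<in>UNIV. t i powr \<kappa>)"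
proof -
  define m where "m = Max (range t)"
  have m: "t i \<le> m" for i unfolding m_def by (rule Max_ge) auto
  have "m \<in> range t" unfolding m_def by (rule Max_in) auto
  then obtain k where k: "m = t k" by blast
  have "(\<Sum>i\<in>UNIV. t i) \<le> real CARD('d) * m"
    using sum_bounded_above[of UNIV t m] m by simp
  then have "(\<Sum>i\<in>UNIV. t i) powr \<kappa> \<le> (real CARD('d) * m) powr \<kappa>"
    using assms by (intro powr_mono2 sum_nonneg) auto
  also have "\<dots> = real CARD('d) powr \<kappa> * t k powr \<kappa>"
    using assms by (simp add: k powr_mult)
  also have "\<dots> \<le> real CARD('d) powr \<kappa> * (\<Sum>i\<in>UNIV. t i powr \<kappa>)"
    by (intro mult_left_mono member_le_sum) auto
  finally show ?thesis .
qed

text \<open>Cauchy's inequality with the radii \<open>t i = ((\<alpha> i + 1) / B) ^ (1 / \<kappa>)\<close>, which up to the \<open>1\<close> minimise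
\<open>t ^ (- \<alpha> i) exp (c t ^ \<kappa>)\<close> for a \<open>c\<close> proportional to \<open>B\<close>; the \<open>1\<close> keeps them positive
when \<open>\<alpha> i = 0\<close>. They turn the growth into \<open>exp (|\<alpha>| + d)\<close>, and the product of the powers is at
least a power of the factorial, because \<open>n! \<le> (n + 1) ^ n\<close>. The constant \<open>B = r d ^ \<kappa>\<close> comes
from comparing the norm of \<open>z\<close> with its coordinates.\<close>

lemma decay_of_taylor:
  fixes F :: "complex ^ 'd::finite \<Rightarrow> complex"
  assumes F: "entire F" and N: "\<And>z. cmod (F z) \<le> N * exp (r * norm z powr \<kappa>)"
    and "r > 0" "R > 0" "\<tau> \<ge> 0" and \<kappa>: "\<kappa> = 1 / (\<tau> + 1/2)"
    and R: "2 * exp 1 * (r * real CARD('d) powr \<kappa>) powr (1 / \<kappa>) * R \<le> 1"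
  shows "cmod (of_real (sqrt (mi_fact \<alpha>)) * taylor F \<alpha> * factorial_weight R \<tau> \<alpha>)
    \<le> N * exp (real CARD('d)) * (1/2) ^ mi_abs \<alpha>"
proof -
  define B where "B = r * real CARD('d) powr \<kappa>"
  define b where "b = B powr (1 / \<kappa>)"
  define t where "t i = ((real (\<alpha> i) + 1) / B) powr (1 / \<kappa>)" for i
  have \<kappa>0: "\<kappa> > 0" using \<kappa> assms(5) by simp
  have \<rho>: "1 / \<kappa> = \<tau> + 1/2" using \<kappa> by simp
  have B: "B > 0" unfolding B_def using assms(3) by simp
  have b: "b > 0" unfolding b_def using B by simp
  have t: "t i > 0" for i unfolding t_def using B by simp
  have N0: "N \<ge> 0"
    using order_trans[OF norm_ge_zero N[of 0]] by (simp add: zero_le_mult_iff)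
  let ?n = "mi_abs \<alpha>" and ?d = "real CARD('d)"
  have "cmod (taylor F \<alpha>) * (\<Prod>i\<in>UNIV. t i ^ \<alpha> i) \<le> N * exp (real ?n + ?d)"
  proof (rule Cauchy_inequality_taylor[OF F t])
    fix z :: "complex ^ 'd" assume z: "\<And>i. cmod (z $ i) = t i"
    have "norm z powr \<kappa> \<le> (\<Sum>i\<in>UNIV. t i) powr \<kappa>"
      using norm_le_sum_coordinates[of z] z \<kappa>0 by (intro powr_mono2) auto
    also have "\<dots> \<le> ?d powr \<kappa> * (\<Sum>i\<in>UNIV. t i powr \<kappa>)"
      using t \<kappa>0 by (intro sum_powr_le) (auto intro: less_imp_le)
    also have "(\<Sum>i\<in>UNIV. t i powr \<kappa>) = (\<Sum>i\<in>UNIV. (real (\<alpha> i) + 1) / B)"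
      unfolding t_def using \<kappa>0 B by (intro sum.cong) (auto simp: powr_powr)
    also have "\<dots> = (real ?n + ?d) / B"
      by (simp add: mi_abs_def sum.distrib sum_divide_distrib[symmetric])
    finally have "r * norm z powr \<kappa> \<le> r * (?d powr \<kappa> * ((real ?n + ?d) / B))"
      using assms(3) by (intro mult_left_mono) auto
    also have "\<dots> = B * ((real ?n + ?d) / B)" by (simp only: B_def mult.assoc)
    also have "\<dots> = real ?n + ?d" using B by simp
    finally have "exp (r * norm z powr \<kappa>) \<le> exp (real ?n + ?d)" by simp
    then show "cmod (F z) \<le> N * exp (real ?n + ?d)"
      using N[of z] N0 by (meson mult_left_mono order_trans)
  qed
  moreover have "mi_fact \<alpha> powr (1 / \<kappa>) / b ^ ?n \<le> (\<Prod>i\<in>UNIV. t i ^ \<alpha> i)"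
  proof -
    have "mi_fact \<alpha> powr (1 / \<kappa>) / b ^ ?n = (\<Prod>i\<in>UNIV. fact (\<alpha> i) powr (1 / \<kappa>) / b ^ \<alpha> i)"
      by (simp add: mi_fact_powr power_mi_abs prod_dividef)
    also have "\<dots> \<le> (\<Prod>i\<in>UNIV. t i ^ \<alpha> i)"
    proof (intro prod_mono conjI)
      fix i
      have "fact (\<alpha> i) \<le> real (\<alpha> i ^ \<alpha> i)" by (rule fact_le_power)
      also have "\<dots> \<le> (real (\<alpha> i) + 1) ^ \<alpha> i" by (simp add: power_mono)
      finally have "fact (\<alpha> i) powr (1 / \<kappa>) \<le> ((real (\<alpha> i) + 1) ^ \<alpha> i) powr (1 / \<kappa>)"
        using \<kappa>0 by (intro powr_mono2) auto
      also have "\<dots> = ((real (\<alpha> i) + 1) powr (1 / \<kappa>)) ^ \<alpha> i"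
        by (simp add: powr_realpow[symmetric] powr_powr mult.commute)
      finally show "fact (\<alpha> i) powr (1 / \<kappa>) / b ^ \<alpha> i \<le> t i ^ \<alpha> i"
        using b B unfolding t_def b_def by (simp add: powr_divide power_divide divide_right_mono)
    qed (use b in auto)
    finally show ?thesis .
  qed
  ultimately have "cmod (taylor F \<alpha>) * (mi_fact \<alpha> powr (1 / \<kappa>) / b ^ ?n) \<le> N * exp (real ?n + ?d)"
    by (meson mult_left_mono norm_ge_zero order_trans)
  then have "cmod (taylor F \<alpha>) * mi_fact \<alpha> powr (1 / \<kappa>) \<le> N * exp (real ?n + ?d) * b ^ ?n"
    using b by (simp add: field_simps)
  also have "\<dots> = N * exp ?d * (exp 1 * b) ^ ?n"
    by (simp add: exp_add power_mult_distrib exp_of_nat_mult[symmetric])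
  finally have *: "cmod (taylor F \<alpha>) * mi_fact \<alpha> powr (1 / \<kappa>) \<le> N * exp ?d * (exp 1 * b) ^ ?n" .
  have "cmod (of_real (sqrt (mi_fact \<alpha>)) * taylor F \<alpha> * factorial_weight R \<tau> \<alpha>)
      = (cmod (taylor F \<alpha>) * mi_fact \<alpha> powr (1 / \<kappa>)) * R ^ ?n"
    using assms(4) mi_fact_pos[of \<alpha>] unfolding \<rho>
    by (simp add: norm_mult norm_power factorial_weight_def powr_add powr_half_sqrt)
  also have "\<dots> \<le> N * exp ?d * (exp 1 * b) ^ ?n * R ^ ?n"
    using assms(4) by (intro mult_right_mono *) auto
  also have "\<dots> = N * exp ?d * (exp 1 * b * R) ^ ?n" by (simp add: power_mult_distrib)
  also have "\<dots> \<le> N * exp ?d * (1/2) ^ ?n"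
    using R N0 b assms(4) unfolding B_def[symmetric] b_def[symmetric]
    by (intro mult_left_mono power_mono) auto
  finally show ?thesis .
qed

section \<open>Summation and Taylor coefficients as continuous maps\<close>

definition series_map :: "'d::finite formal_series \<Rightarrow> complex ^ 'd \<Rightarrow> complex"
  where "series_map c = power_series (normalize_coeffs c)"

definition coeff_map :: "(complex ^ 'd::finite \<Rightarrow> complex) \<Rightarrow> 'd formal_series"
  where "coeff_map F \<alpha> = of_real (sqrt (mi_fact \<alpha>)) * taylor F \<alpha>"

lemma normalize_coeff_map: "normalize_coeffs (coeff_map F) = taylor F"
  using mi_fact_pos by (auto simp: fun_eq_iff normalize_coeffs_def coeff_map_def less_le)

lemma series_map_coeff_map: "entire F \<Longrightarrow> series_map (coeff_map F) = F"
  by (simp add: series_map_def normalize_coeff_map power_series_taylor)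

lemma coeff_map_series_map:
  assumes "entire_coeffs (normalize_coeffs c)"
  shows "coeff_map (series_map c) = c"
  using mi_fact_pos taylor_power_series[OF assms]
  by (auto simp: fun_eq_iff coeff_map_def series_map_def normalize_coeffs_def less_le)

lemma normalize_coeffs_lincomb:
  "normalize_coeffs (\<lambda>\<alpha>. a * c \<alpha> + b * c' \<alpha>) = (\<lambda>\<alpha>. a * normalize_coeffs c \<alpha> + b * normalize_coeffs c' \<alpha>)"
  by (simp add: normalize_coeffs_def fun_eq_iff add_divide_distrib)

lemma series_map_lincomb:
  assumes "entire_coeffs (normalize_coeffs c)" "entire_coeffs (normalize_coeffs c')"
  shows "series_map (\<lambda>\<alpha>. a * c \<alpha> + b * c' \<alpha>) = (\<lambda>z. a * series_map c z + b * series_map c' z)"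
  unfolding series_map_def normalize_coeffs_lincomb by (intro ext power_series_lincomb assms)

lemma lincomb_eq_power_series:
  assumes "entire F" "entire G"
  shows "(\<lambda>z. a * F z + b * G z) = power_series (\<lambda>\<alpha>. a * taylor F \<alpha> + b * taylor G \<alpha>)"
    and "entire_coeffs (\<lambda>\<alpha>. a * taylor F \<alpha> + b * taylor G \<alpha>)"
proof -
  note ec = entire_coeffs_taylor[OF assms(1)] entire_coeffs_taylor[OF assms(2)]
  show "(\<lambda>z. a * F z + b * G z) = power_series (\<lambda>\<alpha>. a * taylor F \<alpha> + b * taylor G \<alpha>)"
    by (rule ext) (simp add: power_series_lincomb[OF ec] power_series_taylor assms)
  show "entire_coeffs (\<lambda>\<alpha>. a * taylor F \<alpha> + b * taylor G \<alpha>)"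
    by (rule entire_coeffs_lincomb[OF ec])
qed

lemma entire_lincomb:
  assumes "entire F" "entire G"
  shows "entire (\<lambda>z. a * F z + b * G z)"
  unfolding lincomb_eq_power_series(1)[OF assms] by (rule entire_power_series[OF lincomb_eq_power_series(2)[OF assms]])

lemma coeff_map_lincomb:
  assumes "entire F" "entire G"
  shows "coeff_map (\<lambda>z. a * F z + b * G z) = (\<lambda>\<alpha>. a * coeff_map F \<alpha> + b * coeff_map G \<alpha>)"
  unfolding coeff_map_def lincomb_eq_power_series(1)[OF assms] taylor_power_series[OF lincomb_eq_power_series(2)[OF assms]]
  by (simp add: fun_eq_iff algebra_simps)

lemma dominated_lincomb:
  fixes F G :: "'x \<Rightarrow> complex"
  assumes "dominated (\<lambda>z. cmod (F z)) w" "dominated (\<lambda>z. cmod (G z)) w"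
  shows "dominated (\<lambda>z. cmod (a * F z + b * G z)) w"
proof -
  obtain C C' where C: "C > 0" "\<And>z. cmod (F z) \<le> C * w z" "C' > 0" "\<And>z. cmod (G z) \<le> C' * w z"
    using assms unfolding dominated_def by blast
  have w: "w z \<ge> 0" for z
    using order_trans[OF norm_ge_zero C(2)[of z]] C(1) by (simp add: zero_le_mult_iff)
  have "cmod (a * F z + b * G z) \<le> (cmod a * C + cmod b * C' + 1) * w z" for z
  proof -
    have "cmod (a * F z + b * G z) \<le> cmod a * cmod (F z) + cmod b * cmod (G z)"
      by (metis norm_mult norm_triangle_ineq)
    also have "\<dots> \<le> cmod a * (C * w z) + cmod b * (C' * w z)"
      by (intro add_mono mult_left_mono C) auto
    also have "\<dots> \<le> (cmod a * C + cmod b * C' + 1) * w z" using w[of z] by (simp add: algebra_simps)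
    finally show ?thesis .
  qed
  moreover have "cmod a * C + cmod b * C' + 1 > 0" using C by (simp add: add_nonneg_pos)
  ultimately show ?thesis unfolding dominated_def by blast
qed

text \<open>Domination makes the supremum that defines the norm a genuine one; without it the supremum would
carry no information.\<close>

lemma norm_le_weighted_norm:
  fixes F :: "'x \<Rightarrow> complex"
  assumes "dominated (\<lambda>z. cmod (F z)) w" "\<And>z. w z > 0"
  shows "cmod (F z) \<le> (SUP z. cmod (F z) / w z) * w z"
proof -
  obtain C where "\<And>z. cmod (F z) \<le> C * w z" using assms unfolding dominated_def by blast
  then have "\<And>z. cmod (F z) / w z \<le> C" using assms(2) by (simp add: field_simps)
  then have "bdd_above (range (\<lambda>z. cmod (F z) / w z))" by (auto simp: bdd_above_def)
  then have "cmod (F z) / w z \<le> (SUP z. cmod (F z) / w z)" by (intro cSUP_upper) auto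
  then show ?thesis using assms(2)[of z] by (simp add: field_simps)
qed

abbreviation (input) exp_weight :: "real \<Rightarrow> real \<Rightarrow> complex ^ 'd::finite \<Rightarrow> real"
  where "exp_weight \<kappa> r \<equiv> \<lambda>z. exp (r * norm z powr \<kappa>)"

text \<open>One step of the sequence spaces is mapped to one step of the spaces of entire functions. The
constant \<open>G + 1\<close> replaces the natural Lipschitz constant \<open>G\<close> only to make its positivity evident.\<close>

lemma continuous_map_series_map:
  assumes p: "0 < p" and "R > 0" "\<tau> \<ge> 0" and \<kappa>: "\<kappa> = 1 / (\<tau> + 1/2)"
    and r: "real CARD('d) / \<kappa> * (2 / R) powr \<kappa> \<le> r"
  shows "continuous_map (lp_space p (factorial_weight R \<tau>))
    (weighted_entire (exp_weight \<kappa> r :: complex ^ 'd::finite \<Rightarrow> real)) series_map"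
proof -
  define G where "G = (\<Sum>\<^sub>\<infinity>\<alpha>::'d multi_index. (1/2) ^ mi_abs \<alpha> :: real)"
  have G: "G \<ge> 0" unfolding G_def by (intro infsum_nonneg) auto
  have ec: "entire_coeffs (normalize_coeffs c)"
    if "c \<in> lp_set p (factorial_weight R \<tau>)" for c :: "'d formal_series"
    by (rule entire_coeffs_normalize[OF assms(2,3) norm_le_lp_norm[OF p that]])
  have growth: "cmod (series_map c z) \<le> (G * lp_norm p (factorial_weight R \<tau>) c) * exp_weight \<kappa> r z"
    if "c \<in> lp_set p (factorial_weight R \<tau>)" for c :: "'d formal_series" and z
    unfolding series_map_def G_def
    by (rule growth_of_series_map[OF assms(2,3) norm_le_lp_norm[OF p that] \<kappa> r])
  show ?thesis
    unfolding lp_space_def weighted_entire_def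
  proof (rule continuous_map_qnorm[where K = "G + 1"])
    fix c :: "'d formal_series" assume c: "c \<in> lp_set p (factorial_weight R \<tau>)"
    let ?N = "G * lp_norm p (factorial_weight R \<tau>) c"
    have "cmod (series_map c z) \<le> (\<bar>?N\<bar> + 1) * exp_weight \<kappa> r z" for z
      using growth[OF c, of z] mult_right_mono[of ?N "\<bar>?N\<bar> + 1" "exp_weight \<kappa> r z"]
      by (meson abs_ge_self add_increasing2 exp_ge_zero order_trans zero_le_one)
    then have "dominated (\<lambda>z. cmod (series_map c z)) (exp_weight \<kappa> r)"
      unfolding dominated_def by (intro exI[of _ "\<bar>?N\<bar> + 1"]) auto
    then show "series_map c \<in> {F. entire F \<and> dominated (\<lambda>z. cmod (F z)) (exp_weight \<kappa> r)}"
      using entire_power_series[OF ec[OF c]] by (simp add: series_map_def)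
  next
    fix c c' :: "'d formal_series"
    assume c: "c \<in> lp_set p (factorial_weight R \<tau>)" and c': "c' \<in> lp_set p (factorial_weight R \<tau>)"
    let ?d = "\<lambda>\<alpha>. c' \<alpha> - c \<alpha>"
    let ?N = "lp_norm p (factorial_weight R \<tau>) ?d"
    have d: "?d \<in> lp_set p (factorial_weight R \<tau>)" by (rule lp_set_diff[OF p c' c])
    have N: "?N \<ge> 0" using order_trans[OF norm_ge_zero norm_le_lp_norm[OF p d]] .
    have eq: "series_map c' z - series_map c z = series_map ?d z" for z
      using series_map_lincomb[OF ec[OF c'] ec[OF c], of 1 "-1"] by (simp add: fun_eq_iff)
    have "(SUP z. cmod (series_map ?d z) / exp_weight \<kappa> r z) \<le> G * ?N"
      using growth[OF d] by (intro cSUP_least) (auto simp: field_simps)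
    also have "\<dots> \<le> (G + 1) * ?N" using N by (simp add: algebra_simps)
    finally show "(SUP z. cmod (series_map c' z - series_map c z) / exp_weight \<kappa> r z) \<le> (G + 1) * ?N"
      unfolding eq .
  qed (use G in auto)
qed

text \<open>The condition on \<open>R\<close> leaves a factor \<open>(1/2) ^ |\<alpha>|\<close> in the coefficient estimate, and this factor pays
for the passage from a supremum bound to the quasi-norm.\<close>

lemma continuous_map_coeff_map:
  assumes p: "0 < p" and "r > 0" "R > 0" "\<tau> \<ge> 0" and \<kappa>: "\<kappa> = 1 / (\<tau> + 1/2)"
    and R: "2 * exp 1 * (r * real CARD('d) powr \<kappa>) powr (1 / \<kappa>) * R \<le> 1"
  shows "continuous_map (weighted_entire (exp_weight \<kappa> r :: complex ^ 'd::finite \<Rightarrow> real))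
    (lp_space p (factorial_weight R \<tau>)) coeff_map"
proof -
  obtain K where K: "K > 0"
    "\<And>(c :: 'd multi_index \<Rightarrow> complex) \<theta> M. (\<And>\<alpha>. cmod (c \<alpha> * \<theta> \<alpha>) \<le> M * (1/2) ^ mi_abs \<alpha>) \<Longrightarrow>
      c \<in> lp_set p \<theta> \<and> lp_norm p \<theta> c \<le> K * M"
    using geometric_decay_imp_lp[OF p, where 'd = 'd] by blast
  let ?w = "exp_weight \<kappa> r :: complex ^ 'd \<Rightarrow> real"
  let ?E = "{F. entire F \<and> dominated (\<lambda>z. cmod (F z)) ?w}"
  let ?N = "\<lambda>F. SUP z. cmod (F z) / ?w z"
  have est: "coeff_map F \<in> lp_set p (factorial_weight R \<tau>) \<and>
      lp_norm p (factorial_weight R \<tau>) (coeff_map F) \<le> K * (?N F * exp (real CARD('d)))"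
    if F: "F \<in> ?E" for F
  proof (rule K(2))
    fix \<alpha>
    have "cmod (F z) \<le> ?N F * ?w z" for z using F by (intro norm_le_weighted_norm) auto
    then show "cmod (coeff_map F \<alpha> * factorial_weight R \<tau> \<alpha>)
       \<le> ?N F * exp (real CARD('d)) * (1/2) ^ mi_abs \<alpha>"
      unfolding coeff_map_def using F by (intro decay_of_taylor[OF _ _ assms(2-6)]) auto
  qed
  show ?thesis
    unfolding lp_space_def weighted_entire_def
  proof (rule continuous_map_qnorm[where K = "K * exp (real CARD('d))"])
    fix F G assume F: "F \<in> ?E" and G: "G \<in> ?E"
    have "(\<lambda>z. G z - F z) \<in> ?E"
      using F G entire_lincomb[of G F 1 "-1"] dominated_lincomb[of G ?w F 1 "-1"] by simp
    moreover have "coeff_map (\<lambda>z. G z - F z) = (\<lambda>\<alpha>. coeff_map G \<alpha> - coeff_map F \<alpha>)"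
      using coeff_map_lincomb[of G F 1 "-1"] F G by simp
    ultimately show "lp_norm p (factorial_weight R \<tau>) (\<lambda>\<alpha>. coeff_map G \<alpha> - coeff_map F \<alpha>)
        \<le> K * exp (real CARD('d)) * ?N (\<lambda>z. G z - F z)"
      using est[of "\<lambda>z. G z - F z"] by (simp add: mult_ac)
  qed (use est K(1) in auto)
qed

lemma continuous_map_weighted_entire_eval:
  assumes "\<And>z. w z > 0"
  shows "continuous_map (weighted_entire w) euclidean (\<lambda>F. F z)"
proof -
  let ?E = "{F. entire F \<and> dominated (\<lambda>z. cmod (F z)) w}"
  have "openin (weighted_entire w) {F \<in> ?E. F z \<in> U}" if U: "open U" for U
    unfolding weighted_entire_def openin_qnorm_topology
  proof (intro conjI ballI)
    fix F assume F: "F \<in> {F \<in> ?E. F z \<in> U}"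
    then obtain \<epsilon> where \<epsilon>: "\<epsilon> > 0" "\<And>u. dist u (F z) < \<epsilon> \<Longrightarrow> u \<in> U"
      using U unfolding open_dist by blast
    have "G z \<in> U" if G: "G \<in> ?E" "(SUP z. cmod (G z - F z) / w z) < \<epsilon> / w z" for G
    proof -
      have "dominated (\<lambda>z. cmod (G z - F z)) w"
        using dominated_lincomb[of G w F 1 "-1"] F G by simp
      from norm_le_weighted_norm[OF this assms, of z]
      have "cmod (G z - F z) \<le> (SUP z. cmod (G z - F z) / w z) * w z" .
      also have "\<dots> < \<epsilon>" using G(2) assms[of z] by (simp add: field_simps)
      finally show ?thesis by (intro \<epsilon>(2)) (simp add: dist_norm)
    qed
    then show "\<exists>\<epsilon>>0. \<forall>G\<in>?E. (SUP z. cmod (G z - F z) / w z) < \<epsilon> \<longrightarrow> G \<in> {F \<in> ?E. F z \<in> U}"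
      using \<epsilon>(1) assms[of z] by (intro exI[of _ "\<epsilon> / w z"]) auto
  qed blast
  then show ?thesis unfolding continuous_map_def by (simp add: weighted_entire_def)
qed

section \<open>Density of the finite sums\<close>

definition truncate_series :: "nat \<Rightarrow> 'd::finite formal_series \<Rightarrow> 'd formal_series"
  where "truncate_series n c \<alpha> = (if mi_abs \<alpha> \<le> n then c \<alpha> else 0)"

lemma truncate_series_in_A_fin: "truncate_series n c \<in> (A_fin :: 'd::finite formal_series set)"
proof -
  have "{\<alpha>. truncate_series n c \<alpha> \<noteq> 0} \<subseteq> PiE UNIV (\<lambda>_. {..n})"
  proof
    fix \<alpha> assume "\<alpha> \<in> {\<alpha>. truncate_series n c \<alpha> \<noteq> 0}"
    then have "mi_abs \<alpha> \<le> n" by (auto simp: truncate_series_def split: if_splits)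
    moreover have "\<alpha> i \<le> mi_abs \<alpha>" for i unfolding mi_abs_def by (rule member_le_sum) auto
    ultimately show "\<alpha> \<in> PiE UNIV (\<lambda>_. {..n})" by (auto intro: order_trans)
  qed
  moreover have "finite (PiE (UNIV :: 'd set) (\<lambda>_. {..n}))" by (intro finite_PiE) auto
  ultimately show ?thesis unfolding A_fin_def using finite_subset by blast
qed

lemma A_fin_subset_lp_set:
  assumes "0 < p"
  shows "(A_fin :: 'd::finite formal_series set) \<subseteq> lp_set p \<theta>"
proof
  fix c :: "'d formal_series" assume "c \<in> A_fin"
  then have fin: "finite {\<alpha>. c \<alpha> \<noteq> 0}" by (simp add: A_fin_def)
  let ?x = "\<lambda>\<alpha>. cmod (c \<alpha> * \<theta> \<alpha>) * 2 ^ mi_abs \<alpha>"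
  define M where "M = (\<Sum>\<alpha> | c \<alpha> \<noteq> 0. ?x \<alpha>)"
  have "?x \<alpha> \<le> M" for \<alpha>
  proof (cases "c \<alpha> = 0")
    case True then show ?thesis unfolding M_def by (auto intro: sum_nonneg)
  next
    case False then show ?thesis unfolding M_def using fin by (intro member_le_sum) auto
  qed
  then have "cmod (c \<alpha> * \<theta> \<alpha>) \<le> M * (1/2) ^ mi_abs \<alpha>" for \<alpha> by (simp add: power_divide field_simps)
  then show "c \<in> lp_set p \<theta>" using geometric_decay_imp_lp[OF assms, where 'd = 'd] by metis
qed

text \<open>Half of the factor \<open>4\<close>, in the sense \<open>(1/4) ^ |\<alpha>| = (1/2) ^ |\<alpha>| (1/2) ^ |\<alpha>|\<close>, makes the remainder
small beyond degree \<open>n\<close>; the other half makes it summable.\<close>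

lemma truncate_series_tendsto:
  fixes c :: "'d::finite formal_series"
  assumes p: "0 < p" and "R > 0" and R': "4 * R \<le> R'" and c: "c \<in> lp_set p (factorial_weight R' \<tau>)"
  shows "(\<lambda>n. lp_norm p (factorial_weight R \<tau>) (\<lambda>\<alpha>. truncate_series n c \<alpha> - c \<alpha>)) \<longlonglongrightarrow> 0"
    and "(\<lambda>\<alpha>. truncate_series n c \<alpha> - c \<alpha>) \<in> lp_set p (factorial_weight R \<tau>)"
    and "c \<in> lp_set p (factorial_weight R \<tau>)"
proof -
  obtain K where K: "K > 0"
    "\<And>(c :: 'd multi_index \<Rightarrow> complex) \<theta> M. (\<And>\<alpha>. cmod (c \<alpha> * \<theta> \<alpha>) \<le> M * (1/2) ^ mi_abs \<alpha>) \<Longrightarrow>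
      c \<in> lp_set p \<theta> \<and> lp_norm p \<theta> c \<le> K * M"
    using geometric_decay_imp_lp[OF p, where 'd = 'd] by blast
  define M where "M = lp_norm p (factorial_weight R' \<tau>) c"
  have M: "cmod (c \<alpha> * factorial_weight R' \<tau> \<alpha>) \<le> M" for \<alpha>
    unfolding M_def by (rule norm_le_lp_norm[OF p c])
  have M0: "M \<ge> 0" using order_trans[OF norm_ge_zero M] .
  have le: "cmod (c \<alpha> * factorial_weight R \<tau> \<alpha>) \<le> M * (1/4) ^ mi_abs \<alpha>" for \<alpha>
  proof -
    have "R ^ mi_abs \<alpha> \<le> (R' / 4) ^ mi_abs \<alpha>" using R' assms(2) by (intro power_mono) auto
    then have "cmod (c \<alpha>) * mi_fact \<alpha> powr \<tau> * R ^ mi_abs \<alpha> \<le> cmod (c \<alpha>) * mi_fact \<alpha> powr \<tau> * (R' / 4) ^ mi_abs \<alpha>"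
      by (intro mult_left_mono) auto
    also have "\<dots> = (cmod (c \<alpha>) * mi_fact \<alpha> powr \<tau> * R' ^ mi_abs \<alpha>) * (1/4) ^ mi_abs \<alpha>"
      by (simp add: power_divide)
    also have "cmod (c \<alpha>) * mi_fact \<alpha> powr \<tau> * R' ^ mi_abs \<alpha> = cmod (c \<alpha> * factorial_weight R' \<tau> \<alpha>)"
      using assms(2) R' by (simp add: norm_mult norm_power factorial_weight_def)
    also have "\<dots> * (1/4) ^ mi_abs \<alpha> \<le> M * (1/4) ^ mi_abs \<alpha>"
      by (intro mult_right_mono M) auto
    finally show ?thesis using assms(2) by (simp add: norm_mult norm_power factorial_weight_def mult_ac)
  qed
  have q: "(1/4::real) ^ m = (1/2) ^ m * (1/2) ^ m" for m
    by (simp add: power_mult_distrib[symmetric])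
  have est: "(\<lambda>\<alpha>. truncate_series n c \<alpha> - c \<alpha>) \<in> lp_set p (factorial_weight R \<tau>) \<and>
    lp_norm p (factorial_weight R \<tau>) (\<lambda>\<alpha>. truncate_series n c \<alpha> - c \<alpha>) \<le> K * (M * (1/2) ^ n)" for n
  proof (rule K(2))
    fix \<alpha>
    show "cmod ((truncate_series n c \<alpha> - c \<alpha>) * factorial_weight R \<tau> \<alpha>) \<le> M * (1/2) ^ n * (1/2) ^ mi_abs \<alpha>"
    proof (cases "mi_abs \<alpha> \<le> n")
      case False
      then have "(1/2::real) ^ mi_abs \<alpha> \<le> (1/2) ^ n" by (intro power_decreasing) auto
      then have "M * ((1/2) ^ mi_abs \<alpha> * (1/2) ^ mi_abs \<alpha>) \<le> M * ((1/2) ^ n * (1/2) ^ mi_abs \<alpha>)"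
        using M0 by (intro mult_left_mono mult_right_mono) auto
      with le[of \<alpha>] have "cmod (c \<alpha> * factorial_weight R \<tau> \<alpha>) \<le> M * (1/2) ^ n * (1/2) ^ mi_abs \<alpha>"
        unfolding q by (simp add: mult.assoc)
      then show ?thesis using False by (simp add: truncate_series_def norm_mult)
    qed (use M0 in \<open>simp add: truncate_series_def\<close>)
  qed
  then show mem: "(\<lambda>\<alpha>. truncate_series n c \<alpha> - c \<alpha>) \<in> lp_set p (factorial_weight R \<tau>)" for n by blast
  have "(\<lambda>n. (1/2) ^ n :: real) \<longlonglongrightarrow> 0" by (rule LIMSEQ_power_zero) simp
  from tendsto_mult_left[OF this, of "K * M"]
  have lim: "(\<lambda>n. K * (M * (1/2) ^ n)) \<longlonglongrightarrow> 0" by (simp add: mult.assoc)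
  show "(\<lambda>n. lp_norm p (factorial_weight R \<tau>) (\<lambda>\<alpha>. truncate_series n c \<alpha> - c \<alpha>)) \<longlonglongrightarrow> 0"
  proof (rule tendsto_sandwich[OF _ _ tendsto_const lim]; rule always_eventually; rule allI)
    fix n
    show "0 \<le> lp_norm p (factorial_weight R \<tau>) (\<lambda>\<alpha>. truncate_series n c \<alpha> - c \<alpha>)"
      by (rule order_trans[OF norm_ge_zero norm_le_lp_norm[OF p mem]])
    show "lp_norm p (factorial_weight R \<tau>) (\<lambda>\<alpha>. truncate_series n c \<alpha> - c \<alpha>) \<le> K * (M * (1/2) ^ n)"
      using est by blast
  qed
  have "cmod (c \<alpha> * factorial_weight R \<tau> \<alpha>) \<le> M * (1/2) ^ mi_abs \<alpha>" for \<alpha>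
  proof -
    have "M * (1/4) ^ mi_abs \<alpha> \<le> M * (1/2) ^ mi_abs \<alpha>"
      using M0 by (intro mult_left_mono power_mono) auto
    then show ?thesis using le[of \<alpha>] by linarith
  qed
  then show "c \<in> lp_set p (factorial_weight R \<tau>)" using K(2) by blast
qed

lemma series_map_eq_power_series_map:
  assumes "c \<in> A_fin"
  shows "series_map c = power_series_map c"
proof
  fix z
  have "((\<lambda>\<alpha>. normalize_coeffs c \<alpha> * monomial \<alpha> z) has_sum power_series_map c z) UNIV"
    unfolding power_series_map_def
    by (rule has_sum_finite_neutralI[of "{\<alpha>. c \<alpha> \<noteq> 0}"])
      (use assms in \<open>auto simp: A_fin_def normalize_coeffs_def basis_fun_def monomial_def\<close>)
  then show "series_map c z = power_series_map c z"
    unfolding series_map_def power_series_def by (rule infsumI)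
qed

lemma zero_in_weighted_entire:
  assumes "\<And>z. w z > 0"
  shows "(\<lambda>z. 0) \<in> topspace (weighted_entire w)"
proof -
  have "entire (\<lambda>z. 0)"
    unfolding entire_def by (intro allI exI[of _ "\<lambda>v. 0"]) auto
  then show ?thesis
    using assms unfolding weighted_entire_def dominated_def by (auto intro!: exI[of _ 1] less_imp_le)
qed

section \<open>The homeomorphisms\<close>

text \<open>The function \<open>b\<close> lets one proof treat the weights \<open>r ^ |\<alpha>|\<close> and \<open>exp (r |\<alpha>|)\<close> together.
Only arbitrarily large bases matter in a projective limit.\<close>

lemma series_map_homeomorphism_proj:
  fixes b :: "real \<Rightarrow> real"
  assumes p: "0 < p" and \<tau>: "\<tau> \<ge> 0" and \<kappa>: "\<kappa> = 1 / (\<tau> + 1/2)"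
    and b_pos: "\<And>r. r > 0 \<Longrightarrow> b r > 0" and b_large: "\<And>r. r > 0 \<Longrightarrow> b r \<ge> r"
  shows "extends_uniquely_to_homeomorphism
    (power_series_map :: 'd::finite formal_series \<Rightarrow> complex ^ 'd \<Rightarrow> complex) A_fin
    (proj_lim (\<lambda>r. lp_space p (factorial_weight (b r) \<tau>))) (entire_proj (exp_weight \<kappa>))"
proof -
  have \<kappa>0: "\<kappa> > 0" using \<kappa> \<tau> by simp
  let ?L = "\<lambda>r. lp_space p (factorial_weight (b r) \<tau>) :: 'd formal_series topology"
  let ?W = "\<lambda>r. weighted_entire (exp_weight \<kappa> r) :: (complex ^ 'd \<Rightarrow> complex) topology"
  let ?d = "real CARD('d)"
  have topL: "topspace (proj_lim ?L) = (\<Inter>r\<in>{0<..}. lp_set p (factorial_weight (b r) \<tau>))"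
    unfolding topspace_proj_lim lp_space_def by simp
  have T: "continuous_map (proj_lim ?L) (proj_lim ?W) series_map"
  proof (rule continuous_map_proj_lim)
    fix r :: real assume r: "r > 0"
    \<comment> \<open>Solves \<open>d / \<kappa> * (2 / R) ^ \<kappa> = r\<close>; as \<open>b R \<ge> R\<close>, the step \<open>b R\<close> has at most this growth.\<close>
    define R where "R = 2 * (?d / \<kappa> / r) powr (1 / \<kappa>)"
    have R: "R > 0" unfolding R_def using r \<kappa>0 by simp
    have "(2 / b R) powr \<kappa> \<le> (2 / R) powr \<kappa>"
      using b_pos[OF R] b_large[OF R] R \<kappa>0 by (intro powr_mono2) (auto intro: divide_left_mono)
    also have "(2 / R) powr \<kappa> = r / (?d / \<kappa>)"
      using r \<kappa>0 unfolding R_def by (simp add: powr_divide powr_powr)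
    finally have "?d / \<kappa> * (2 / b R) powr \<kappa> \<le> ?d / \<kappa> * (r / (?d / \<kappa>))"
      using \<kappa>0 by (intro mult_left_mono) auto
    also have "\<dots> = r" using \<kappa>0 by simp
    finally show "\<exists>R>0. continuous_map (?L R) (?W r) series_map"
      using R continuous_map_series_map[OF p b_pos[OF R] \<tau> \<kappa>] by blast
  qed
  have S: "continuous_map (proj_lim ?W) (proj_lim ?L) coeff_map"
  proof (rule continuous_map_proj_lim)
    fix R :: real assume "R > 0"
    then have R: "b R > 0" by (rule b_pos)
    \<comment> \<open>Solves the condition of the coefficient estimate with equality.\<close>
    define r where "r = (1 / (2 * exp 1 * b R)) powr \<kappa> / ?d powr \<kappa>"
    have r: "r > 0" unfolding r_def using R by simp
    have "(r * ?d powr \<kappa>) powr (1 / \<kappa>) = 1 / (2 * exp 1 * b R)"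
      using R \<kappa>0 unfolding r_def by (simp add: powr_powr)
    then have "2 * exp 1 * (r * ?d powr \<kappa>) powr (1 / \<kappa>) * b R \<le> 1" using R by simp
    then show "\<exists>r>0. continuous_map (?W r) (?L R) coeff_map"
      using r continuous_map_coeff_map[OF p r R \<tau> \<kappa>] by blast
  qed
  have ST: "coeff_map (series_map c) = c" if c: "c \<in> topspace (proj_lim ?L)" for c
  proof -
    have c1: "c \<in> lp_set p (factorial_weight (b 1) \<tau>)" using c unfolding topL by auto
    show ?thesis
      using entire_coeffs_normalize[OF b_pos[of 1] \<tau> norm_le_lp_norm[OF p c1]] coeff_map_series_map
      by simp
  qed
  have TS: "series_map (coeff_map F) = F" if F: "F \<in> topspace (proj_lim ?W)" for F
    using F series_map_coeff_map unfolding topspace_proj_lim weighted_entire_def by (auto intro: zero_less_one)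
  have hom: "homeomorphic_map (proj_lim ?L) (proj_lim ?W) series_map"
    unfolding homeomorphic_map_maps homeomorphic_maps_def using T S ST TS by blast
  show ?thesis
    unfolding entire_proj_def
  proof (rule extends_uniquely_to_homeomorphismI[OF hom])
    show "A_fin \<subseteq> topspace (proj_lim ?L)"
      unfolding topL using A_fin_subset_lp_set[OF p] by blast
    show "series_map c = power_series_map c" if "c \<in> A_fin" for c :: "'d formal_series"
      by (rule series_map_eq_power_series_map[OF that])
    show "\<exists>s. (\<forall>n::nat. s n \<in> A_fin) \<and> limitin (proj_lim ?L) s c sequentially"
      if c: "c \<in> topspace (proj_lim ?L)" for c
    proof (intro exI[of _ "\<lambda>n. truncate_series n c"] conjI allI truncate_series_in_A_fin limitin_proj_lim)
      fix r :: real assume r: "r > 0"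
      show mem: "truncate_series n c \<in> topspace (?L r)" for n
        unfolding lp_space_def using truncate_series_in_A_fin A_fin_subset_lp_set[OF p] by fastforce
      \<comment> \<open>The step \<open>4 * b r\<close> has a base of at least \<open>4 * b r\<close>, as the convergence of truncations requires.\<close>
      have r': "4 * b r > 0" using b_pos[OF r] by simp
      have "c \<in> lp_set p (factorial_weight (b (4 * b r)) \<tau>)" using c r' unfolding topL by auto
      from truncate_series_tendsto[OF p b_pos[OF r] b_large[OF r'] this]
      show "limitin (?L r) (\<lambda>n. truncate_series n c) c sequentially"
        unfolding lp_space_def using mem by (intro limitin_qnorm) (auto simp: lp_space_def)
    qed
    show "continuous_map (proj_lim ?W) euclidean (\<lambda>F. F z)" for z
      by (rule continuous_map_from_proj_lim[OF zero_less_one]) (rule continuous_map_weighted_entire_eval, simp)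
  qed
qed

lemma factorial_weight_mono:
  assumes "0 < R" "R \<le> R'"
  shows "factorial_weight R \<tau> \<alpha> \<le> factorial_weight R' \<tau> \<alpha>"
  unfolding factorial_weight_def using assms by (intro mult_right_mono power_mono) auto

text \<open>On the union the exponent \<open>p\<close> disappears, as halving \<open>R\<close> supplies geometric decay. Closure under linear
combinations is then elementary.\<close>

lemma Union_lp_set_iff:
  assumes p: "0 < p"
  shows "c \<in> (\<Union>R\<in>{0<..}. lp_set p (factorial_weight R \<tau>)) \<longleftrightarrow>
    (\<exists>R>0. \<exists>M. \<forall>\<alpha>. cmod (c \<alpha>) * factorial_weight R \<tau> \<alpha> \<le> M)"
proof
  assume "c \<in> (\<Union>R\<in>{0<..}. lp_set p (factorial_weight R \<tau>))"
  then obtain R where R: "R > 0" "c \<in> lp_set p (factorial_weight R \<tau>)" by auto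
  have "cmod (c \<alpha>) * factorial_weight R \<tau> \<alpha> \<le> lp_norm p (factorial_weight R \<tau>) c" for \<alpha>
    using norm_le_lp_norm[OF p R(2), of \<alpha>] R(1) by (simp add: norm_mult norm_power factorial_weight_def)
  then show "\<exists>R>0. \<exists>M. \<forall>\<alpha>. cmod (c \<alpha>) * factorial_weight R \<tau> \<alpha> \<le> M" using R(1) by blast
next
  assume "\<exists>R>0. \<exists>M. \<forall>\<alpha>. cmod (c \<alpha>) * factorial_weight R \<tau> \<alpha> \<le> M"
  then obtain R M where R: "R > 0" and M: "\<And>\<alpha>. cmod (c \<alpha>) * factorial_weight R \<tau> \<alpha> \<le> M" by blast
  have "cmod (c \<alpha> * factorial_weight (R / 2) \<tau> \<alpha>) \<le> M * (1/2) ^ mi_abs \<alpha>" for \<alpha>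
    using M[of \<alpha>] R by (simp add: norm_mult norm_power norm_divide factorial_weight_def power_divide field_simps)
  then have "c \<in> lp_set p (factorial_weight (R / 2) \<tau>)"
    using geometric_decay_imp_lp[OF p, where 'd = 'a] by metis
  then show "c \<in> (\<Union>R\<in>{0<..}. lp_set p (factorial_weight R \<tau>))" using R by (auto intro!: bexI[of _ "R / 2"])
qed

lemma Union_lp_set_lincomb:
  assumes p: "0 < p"
    and "c \<in> (\<Union>R\<in>{0<..}. lp_set p (factorial_weight R \<tau>))" "c' \<in> (\<Union>R\<in>{0<..}. lp_set p (factorial_weight R \<tau>))"
  shows "(\<lambda>\<alpha>. a * c \<alpha> + b * c' \<alpha>) \<in> (\<Union>R\<in>{0<..}. lp_set p (factorial_weight R \<tau>))"
proof -
  obtain R M R' M' where R: "R > 0" "R' > 0"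
    and M: "\<And>\<alpha>. cmod (c \<alpha>) * factorial_weight R \<tau> \<alpha> \<le> M"
    and M': "\<And>\<alpha>. cmod (c' \<alpha>) * factorial_weight R' \<tau> \<alpha> \<le> M'"
    using assms unfolding Union_lp_set_iff[OF p] by blast
  define R0 where "R0 = min R R'"
  have R0: "R0 > 0" "R0 \<le> R" "R0 \<le> R'" using R unfolding R0_def by auto
  have "cmod (a * c \<alpha> + b * c' \<alpha>) * factorial_weight R0 \<tau> \<alpha> \<le> cmod a * M + cmod b * M'" for \<alpha>
  proof -
    let ?w = "factorial_weight R0 \<tau> \<alpha>"
    have w: "?w \<ge> 0" using R0 by (simp add: factorial_weight_def)
    have 1: "cmod (c \<alpha>) * ?w \<le> M"
      using M[of \<alpha>] mult_left_mono[OF factorial_weight_mono[OF R0(1,2)] norm_ge_zero] by (rule order_trans[rotated])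
    have 2: "cmod (c' \<alpha>) * ?w \<le> M'"
      using M'[of \<alpha>] mult_left_mono[OF factorial_weight_mono[OF R0(1,3)] norm_ge_zero] by (rule order_trans[rotated])
    have "cmod (a * c \<alpha> + b * c' \<alpha>) * ?w \<le> (cmod a * cmod (c \<alpha>) + cmod b * cmod (c' \<alpha>)) * ?w"
      using w by (intro mult_right_mono) (metis norm_mult norm_triangle_ineq)
    also have "\<dots> = cmod a * (cmod (c \<alpha>) * ?w) + cmod b * (cmod (c' \<alpha>) * ?w)" by (simp add: algebra_simps)
    also have "\<dots> \<le> cmod a * M + cmod b * M'" by (intro add_mono mult_left_mono 1 2) auto
    finally show ?thesis .
  qed
  then show ?thesis unfolding Union_lp_set_iff[OF p] using R0(1) by blast
qed

lemma Union_weighted_entire_lincomb: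
  fixes F G :: "complex ^ 'd::finite \<Rightarrow> complex"
  assumes "F \<in> (\<Union>r\<in>{0<..}. topspace (weighted_entire (exp_weight \<kappa> r)))"
    "G \<in> (\<Union>r\<in>{0<..}. topspace (weighted_entire (exp_weight \<kappa> r)))"
  shows "(\<lambda>z. a * F z + b * G z) \<in> (\<Union>r\<in>{0<..}. topspace (weighted_entire (exp_weight \<kappa> r)))"
proof -
  obtain r r' where r: "r > 0" "r' > 0" and F: "entire F" "dominated (\<lambda>z. cmod (F z)) (exp_weight \<kappa> r)"
    and G: "entire G" "dominated (\<lambda>z. cmod (G z)) (exp_weight \<kappa> r')"
    using assms by (auto simp: weighted_entire_def)
  define r0 where "r0 = max r r'"
  have mono: "dominated (\<lambda>z. cmod (H z)) (exp_weight \<kappa> r0)"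
    if H: "dominated (\<lambda>z. cmod (H z)) (exp_weight \<kappa> s)" "s \<le> r0" for H :: "complex ^ 'd \<Rightarrow> complex" and s
  proof -
    obtain C where C: "C > 0" "\<And>z. cmod (H z) \<le> C * exp_weight \<kappa> s z" using H(1) unfolding dominated_def by blast
    have "C * exp_weight \<kappa> s z \<le> C * exp_weight \<kappa> r0 z" for z :: "complex ^ 'd"
      using C(1) H(2) by (intro mult_left_mono) (auto intro: mult_right_mono)
    then show ?thesis using C unfolding dominated_def by (meson order_trans)
  qed
  have "dominated (\<lambda>z. cmod (a * F z + b * G z)) (exp_weight \<kappa> r0)"
    by (intro dominated_lincomb mono[OF F(2)] mono[OF G(2)]) (auto simp: r0_def)
  then show ?thesis
    using entire_lincomb[OF F(1) G(1)] r by (auto simp: weighted_entire_def r0_def intro!: bexI[of _ r0])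
qed

text \<open>The estimates are the same as for the projective limit, but now a target step is found for each
given source step, so \<open>r\<close> and \<open>R\<close> are chosen in the opposite order.\<close>

lemma series_map_homeomorphism_ind:
  assumes p: "0 < p" and \<tau>: "\<tau> \<ge> 0" and \<kappa>: "\<kappa> = 1 / (\<tau> + 1/2)"
  shows "extends_uniquely_to_homeomorphism
    (power_series_map :: 'd::finite formal_series \<Rightarrow> complex ^ 'd \<Rightarrow> complex) A_fin
    (ind_lim (\<lambda>r. lp_space p (factorial_weight r \<tau>))) (entire_ind (exp_weight \<kappa>))"
proof -
  have \<kappa>0: "\<kappa> > 0" using \<kappa> \<tau> by simp
  let ?L = "\<lambda>r. lp_space p (factorial_weight r \<tau>) :: 'd formal_series topology"
  let ?W = "\<lambda>r. weighted_entire (exp_weight \<kappa> r) :: (complex ^ 'd \<Rightarrow> complex) topology"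
  let ?d = "real CARD('d)"
  define EL where "EL = (\<Union>r\<in>{0<..}. topspace (?L r))"
  define EW where "EW = (\<Union>r\<in>{0<..}. topspace (?W r))"
  have EL: "EL = (\<Union>r\<in>{0<..}. lp_set p (factorial_weight r \<tau>))" unfolding EL_def lp_space_def by simp
  have zeroL: "(\<lambda>\<alpha>. 0) \<in> topspace (?L r)" for r
    using subsetD[OF A_fin_subset_lp_set[OF p], of "\<lambda>_. 0"] by (simp add: lp_space_def A_fin_def)
  have zeroW: "(\<lambda>z. 0) \<in> topspace (?W r)" for r by (rule zero_in_weighted_entire) simp
  have topL: "topspace (ind_lim ?L) = EL" unfolding EL_def by (rule topspace_ind_lim) (rule zeroL)
  have topW: "topspace (ind_lim ?W) = EW" unfolding EW_def by (rule topspace_ind_lim) (rule zeroW)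
  have ec: "entire_coeffs (normalize_coeffs c)" if c: "c \<in> EL" for c
  proof -
    obtain r where r: "r > 0" "c \<in> lp_set p (factorial_weight r \<tau>)" using c unfolding EL by auto
    show ?thesis by (rule entire_coeffs_normalize[OF r(1) \<tau> norm_le_lp_norm[OF p r(2)]])
  qed
  have ent: "entire F" if "F \<in> EW" for F using that unfolding EW_def by (auto simp: weighted_entire_def)
  have subL: "(\<lambda>x. a * f x + b * g x) \<in> EL" if "f \<in> EL" "g \<in> EL" for a b f g
    using that unfolding EL by (rule Union_lp_set_lincomb[OF p])
  have linL: "series_map (\<lambda>x. a * f x + b * g x) = (\<lambda>x. a * series_map f x + b * series_map g x)"
    if "f \<in> EL" "g \<in> EL" for a b f g
    by (rule series_map_lincomb[OF ec[OF that(1)] ec[OF that(2)]])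
  have subW: "(\<lambda>x. a * f x + b * g x) \<in> EW" if "f \<in> EW" "g \<in> EW" for a b f g
    using that unfolding EW_def by (rule Union_weighted_entire_lincomb)
  have linW: "coeff_map (\<lambda>x. a * f x + b * g x) = (\<lambda>x. a * coeff_map f x + b * coeff_map g x)"
    if "f \<in> EW" "g \<in> EW" for a b f g
    by (rule coeff_map_lincomb[OF ent[OF that(1)] ent[OF that(2)]])
  have T: "continuous_map (ind_lim ?L) (ind_lim ?W) series_map"
  proof (rule continuous_map_ind_lim[where X = ?L and Y = ?W and \<Phi> = series_map and E = EL])
    fix R :: real assume R: "R > 0"
    define r where "r = ?d / \<kappa> * (2 / R) powr \<kappa>"
    have "r > 0" unfolding r_def using R \<kappa>0 by simp
    moreover have "continuous_map (?L R) (?W r) series_map"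
      by (rule continuous_map_series_map[OF p R \<tau> \<kappa>]) (simp add: r_def)
    ultimately show "\<exists>r>0. continuous_map (?L R) (?W r) series_map" by (intro exI[of _ r] conjI)
  qed (rule zeroL zeroW EL_def subL linL; assumption)+
  have S: "continuous_map (ind_lim ?W) (ind_lim ?L) coeff_map"
  proof (rule continuous_map_ind_lim[where X = ?W and Y = ?L and \<Phi> = coeff_map and E = EW])
    fix r :: real assume r: "r > 0"
    define R where "R = 1 / (2 * exp 1 * (r * ?d powr \<kappa>) powr (1 / \<kappa>))"
    have R: "R > 0" unfolding R_def using r by simp
    have "2 * exp 1 * (r * ?d powr \<kappa>) powr (1 / \<kappa>) * R \<le> 1" unfolding R_def using r by simp
    from continuous_map_coeff_map[OF p r R \<tau> \<kappa> this] R
    show "\<exists>R>0. continuous_map (?W r) (?L R) coeff_map"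
      by (intro exI[of _ R] conjI)
  qed (rule zeroL zeroW EW_def subW linW; assumption)+
  have hom: "homeomorphic_map (ind_lim ?L) (ind_lim ?W) series_map"
    unfolding homeomorphic_map_maps homeomorphic_maps_def topL topW
    using T S coeff_map_series_map[OF ec] series_map_coeff_map[OF ent] by blast
  show ?thesis
    unfolding entire_ind_def
  proof (rule extends_uniquely_to_homeomorphismI[OF hom])
    show fin: "A_fin \<subseteq> topspace (ind_lim ?L)"
      unfolding topL EL using A_fin_subset_lp_set[OF p] by (meson UN_upper greaterThan_iff order_trans zero_less_one)
    show "series_map c = power_series_map c" if "c \<in> A_fin" for c :: "'d formal_series"
      by (rule series_map_eq_power_series_map[OF that])
    show "\<exists>s. (\<forall>n::nat. s n \<in> A_fin) \<and> limitin (ind_lim ?L) s c sequentially"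
      if c: "c \<in> topspace (ind_lim ?L)" for c
    proof -
      obtain R where R: "R > 0" "c \<in> lp_set p (factorial_weight R \<tau>)" using c unfolding topL EL by auto
      have "R / 4 > 0" "4 * (R / 4) \<le> R" using R by auto
      note trunc = truncate_series_tendsto[OF p this R(2)]
      have "limitin (?L (R / 4)) (\<lambda>n \<alpha>. truncate_series n c \<alpha> - c \<alpha>) (\<lambda>\<alpha>. 0) sequentially"
        unfolding lp_space_def
        by (rule limitin_qnorm) (use trunc zeroL in \<open>auto simp: lp_space_def\<close>)
      then have "limitin (ind_lim ?L) (\<lambda>n. truncate_series n c) c sequentially"
      proof (rule limitin_ind_lim[where X = ?L, OF \<open>R / 4 > 0\<close>])
        show "truncate_series n c \<in> topspace (ind_lim ?L)" for n
          by (rule subsetD[OF fin truncate_series_in_A_fin])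
      qed (rule zeroL c)+
      then show ?thesis
        by (intro exI[of _ "\<lambda>n. truncate_series n c"] conjI allI truncate_series_in_A_fin)
    qed
    show "continuous_map (ind_lim ?W) euclidean (\<lambda>F. F z)" for z
      by (rule continuous_map_eval_ind_lim[OF continuous_map_weighted_entire_eval zeroW]) simp
  qed
qed

theorem theorem4p1:
  fixes p :: ereal
  assumes "0 < p"
  shows "(\<forall>\<sigma>::ereal. 0 < \<sigma> \<longrightarrow>
      extends_uniquely_to_homeomorphism
        (power_series_map :: 'd::finite formal_series \<Rightarrow> complex ^ 'd \<Rightarrow> complex) A_fin
        (A_proj p (flat \<sigma>))
        (entire_proj (\<lambda>r z. exp (r * norm z powr kappa1 \<sigma>))))
    \<and> (\<forall>\<sigma>::ereal. 0 < \<sigma> \<and> \<sigma> < \<infinity> \<longrightarrow>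
      extends_uniquely_to_homeomorphism
        (power_series_map :: 'd::finite formal_series \<Rightarrow> complex ^ 'd \<Rightarrow> complex) A_fin
        (A_ind p (flat \<sigma>))
        (entire_ind (\<lambda>r z. exp (r * norm z powr kappa1 \<sigma>))))"
proof (intro conjI allI impI)
  have finite_index: "0 \<le> 1 / (2 * real_of_ereal \<sigma>)" "kappa1 \<sigma> = 1 / (1 / (2 * real_of_ereal \<sigma>) + 1/2)"
      "vartheta r (flat \<sigma>) = (factorial_weight r (1 / (2 * real_of_ereal \<sigma>)) :: 'd multi_index \<Rightarrow> real)"
    if \<sigma>: "0 < \<sigma>" "\<sigma> \<noteq> \<infinity>" for \<sigma> :: ereal and r
  proof -
    obtain s where s: "\<sigma> = ereal s" "s > 0" using \<sigma> by (cases \<sigma>) auto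
    show "0 \<le> 1 / (2 * real_of_ereal \<sigma>)" "kappa1 \<sigma> = 1 / (1 / (2 * real_of_ereal \<sigma>) + 1/2)"
      using s by (auto simp: kappa1_def field_simps)
    show "vartheta r (flat \<sigma>) = (factorial_weight r (1 / (2 * real_of_ereal \<sigma>)) :: 'd multi_index \<Rightarrow> real)"
      using s by (simp add: flat_def factorial_weight_def fun_eq_iff)
  qed
  fix \<sigma> :: ereal
  show "extends_uniquely_to_homeomorphism
        (power_series_map :: 'd::finite formal_series \<Rightarrow> complex ^ 'd \<Rightarrow> complex) A_fin
        (A_proj p (flat \<sigma>)) (entire_proj (\<lambda>r z. exp (r * norm z powr kappa1 \<sigma>)))" if \<sigma>: "0 < \<sigma>"
  proof (cases "\<sigma> = \<infinity>")
    case True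
    have "vartheta r (flat \<sigma>) = (factorial_weight (exp r) 0 :: 'd multi_index \<Rightarrow> real)" for r
    proof
      fix \<alpha> :: "'d multi_index"
      show "vartheta r (flat \<sigma>) \<alpha> = factorial_weight (exp r) 0 \<alpha>"
        using True mi_fact_pos[of \<alpha>]
        by (simp add: flat_def factorial_weight_def exp_of_nat_mult[symmetric] mult.commute)
    qed
    moreover have "kappa1 \<sigma> = 1 / (0 + 1/2)" using True by (simp add: kappa1_def)
    moreover have "r \<le> exp r" for r :: real using exp_ge_add_one_self[of r] by linarith
    ultimately show ?thesis
      unfolding A_proj_def using series_map_homeomorphism_proj[OF assms order_refl, of "kappa1 \<sigma>" exp] by simp
  next
    case False
    show ?thesis
      unfolding A_proj_def finite_index(3)[OF \<sigma> False]
      by (rule series_map_homeomorphism_proj[OF assms finite_index(1,2)[OF \<sigma> False]]) auto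
  qed
  show "extends_uniquely_to_homeomorphism
        (power_series_map :: 'd::finite formal_series \<Rightarrow> complex ^ 'd \<Rightarrow> complex) A_fin
        (A_ind p (flat \<sigma>)) (entire_ind (\<lambda>r z. exp (r * norm z powr kappa1 \<sigma>)))" if \<sigma>: "0 < \<sigma> \<and> \<sigma> < \<infinity>"
  proof -
    have \<sigma>': "0 < \<sigma>" "\<sigma> \<noteq> \<infinity>" using \<sigma> by auto
    show ?thesis
      unfolding A_ind_def finite_index(3)[OF \<sigma>']
      by (rule series_map_homeomorphism_ind[OF assms finite_index(1,2)[OF \<sigma>']])
  qed
qed

end
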